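(* Let $n\geq3$ and let $\rho_{A_1A_2A_3}$ be a state on $H_{A_1}\otimes H_{A_2}\otimes H_{A_3}$ with $\dim H_{A_1}=\dim H_{A_2}=2$, $\dim H_{A_3}=2^{n-2}$. Let $k\geq 1$, $0<q\leq 1$, $0<s\leq 1$, $\beta\geq s$. (1) If $\mathcal N_a^s(\rho_{A_1A_3})\geq k\,\mathcal N_a^s(\rho_{A_1A_2})$, then $$\mathcal N_a^\beta(\rho_{A_1|A_2A_3})\leq q^{\beta/s}\mathcal N_a^\beta(\rho_{A_1A_2})+\frac{(1+k)^{\beta/s}-q^{\beta/s}}{k^{\beta/s}}\mathcal N_a^\beta(\rho_{A_1A_3}).$$ (2) If $\mathcal N_a^s(\rho_{A_1A_2})\geq k\,\mathcal N_a^s(\rho_{A_1A_3})$, then $$\mathcal N_a^\beta(\rho_{A_1|A_2A_3})\leq q^{\beta/s}\mathcal N_a^\beta(\rho_{A_1A_3})+\frac{(1+k)^{\beta/s}-q^{\beta/s}}{k^{\beta/s}}\mathcal N_a^\beta(\rho_{A_1A_2}).$$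
   Context: For a bipartite pure state $|\varphi\rangle_{XY}$, its negativity is $\mathcal N(|\varphi\rangle)=\|(|\varphi\rangle\langle\varphi|)^{T_X}\|_{tr}-1$, where $T_X$ is the partial transpose with respect to $X$ and $\|\cdot\|_{tr}$ is the trace norm (sum of singular values); equivalently $\mathcal N(|\varphi\rangle)=(\mathrm{tr}\sqrt{\rho_X})^2-1$ with $\rho_X=\mathrm{tr}_Y|\varphi\rangle\langle\varphi|$. The (convex-roof extended) negativity of assistance of a bipartite state $\rho_{XY}$ is $\mathcal N_a(\rho_{XY})=\max\sum_ip_i\mathcal N(|\varphi_i\rangle)$, the maximum over all pure-state ensembles $\{p_i,|\varphi_i\rangle\}$ with $\rho_{XY}=\sum_ip_i|\varphi_i\rangle\langle\varphi_i|$. $\rho_{A_1A_2},\rho_{A_1A_3}$ are reduced states, and $\rho_{A_1|A_2A_3}$ is $\rho_{A_1A_2A_3}$ viewed as a bipartite state for the cut $A_1$ versus $A_2A_3$. *)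

theory Defs
  imports "Jordan_Normal_Form.Matrix" Complex_Main
begin

text \<open>Conventions. A system of dimension dA*dB is indexed by a*dB+b (Kronecker order).
A tripartite system of dimensions d1,d2,d3 is indexed by i1*(d2*d3)+i2*d3+i3.\<close>

definition quad_form :: "nat \<Rightarrow> complex mat \<Rightarrow> complex vec \<Rightarrow> complex" where
  "quad_form d A v = (\<Sum>i<d. \<Sum>j<d. cnj (v $ i) * A $$ (i, j) * v $ j)"

definition psd :: "nat \<Rightarrow> complex mat \<Rightarrow> bool" where
  "psd d A \<longleftrightarrow> A \<in> carrier_mat d d \<and>
     (\<forall>v \<in> carrier_vec d. Im (quad_form d A v) = 0 \<and> Re (quad_form d A v) \<ge> 0)"

definition mtrace :: "complex mat \<Rightarrow> complex" where
  "mtrace A = (\<Sum>i<dim_row A. A $$ (i, i))"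

definition density :: "nat \<Rightarrow> complex mat \<Rightarrow> bool" where
  "density d \<rho> \<longleftrightarrow> psd d \<rho> \<and> mtrace \<rho> = 1"

definition mat_sqrt :: "nat \<Rightarrow> complex mat \<Rightarrow> complex mat" where
  "mat_sqrt d A = (THE B. psd d B \<and> B * B = A)"

definition unit_vec :: "nat \<Rightarrow> complex vec \<Rightarrow> bool" where
  "unit_vec d v \<longleftrightarrow> dim_vec v = d \<and> (\<Sum>i<d. (cmod (v $ i))\<^sup>2) = 1"

definition proj :: "complex vec \<Rightarrow> complex mat" where
  "proj v = mat (dim_vec v) (dim_vec v) (\<lambda>(i, j). v $ i * cnj (v $ j))"

definition ptrace_2 :: "nat \<Rightarrow> nat \<Rightarrow> complex mat \<Rightarrow> complex mat" where
  "ptrace_2 dX dY M = mat dX dX (\<lambda>(i, j). \<Sum>b<dY. M $$ (i * dY + b, j * dY + b))"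

definition negativity_pure :: "nat \<Rightarrow> nat \<Rightarrow> complex vec \<Rightarrow> real" where
  "negativity_pure dX dY \<psi> = (Re (mtrace (mat_sqrt dX (ptrace_2 dX dY (proj \<psi>)))))\<^sup>2 - 1"

definition pure_ensemble :: "nat \<Rightarrow> complex mat \<Rightarrow> (real \<times> complex vec) list \<Rightarrow> bool" where
  "pure_ensemble d \<rho> E \<longleftrightarrow>
     (\<forall>(p, \<psi>) \<in> set E. p \<ge> 0 \<and> unit_vec d \<psi>) \<and>
     \<rho> = mat d d (\<lambda>(i, j). \<Sum>(p, \<psi>) \<leftarrow> E. complex_of_real p * \<psi> $ i * cnj (\<psi> $ j))"

definition negativity_assist :: "nat \<Rightarrow> nat \<Rightarrow> complex mat \<Rightarrow> real" where
  "negativity_assist dX dY \<rho> =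
     Sup {(\<Sum>(p, \<psi>) \<leftarrow> E. p * negativity_pure dX dY \<psi>) | E. pure_ensemble (dX * dY) \<rho> E}"

definition reduced_12 :: "nat \<Rightarrow> nat \<Rightarrow> nat \<Rightarrow> complex mat \<Rightarrow> complex mat" where
  "reduced_12 d1 d2 d3 \<rho> = ptrace_2 (d1 * d2) d3 \<rho>"

definition reduced_13 :: "nat \<Rightarrow> nat \<Rightarrow> nat \<Rightarrow> complex mat \<Rightarrow> complex mat" where
  "reduced_13 d1 d2 d3 \<rho> = mat (d1 * d3) (d1 * d3) (\<lambda>(i, j).
     \<Sum>b<d2. \<rho> $$ ((i div d3) * (d2 * d3) + b * d3 + i mod d3,
                    (j div d3) * (d2 * d3) + b * d3 + j mod d3))"

end

theory Submission
  imports Defs "Jordan_Normal_Form.Spectral_Radius"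
begin

text \<open>
  For a qubit \<open>A\<close> the negativity of a pure state is its concurrence, and for an unnormalised
  \<open>|0\<rangle>x + |1\<rangle>y\<close> this is a multiple of the norm of \<open>x \<and> y\<close>. When \<open>x, y\<close> lie in
  \<open>B \<otimes> C\<close>, the bivector splits orthogonally along
  \<open>\<Lambda>\<^sup>2(B \<otimes> C) = (\<Lambda>\<^sup>2B \<otimes> S\<^sup>2C) \<oplus> (S\<^sup>2B \<otimes> \<Lambda>\<^sup>2C)\<close>. An orthonormal measurement of \<open>C\<close>
  produces an ensemble of \<open>\<rho>\<^bsub>AB\<^esub>\<close> whose average concurrence only depends on the diagonal of the
  first component, a complex symmetric matrix; in a Takagi basis the diagonal sum is at least the
  Frobenius norm. Measuring the qubit \<open>B\<close> similarly exhibits the second component, a symmetric 2x2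
  form with vector values; if a basis with diagonal entries of equal length is not good enough, then
  a basis unbiased to it is. Hence the negativity of assistance is subadditive on pure states, and
  on mixed states by concatenating ensembles. The weighted inequality is then a statement
  about real numbers: \<open>u \<mapsto> (1 + u)\<^sup>m - q\<^sup>m u\<^sup>m\<close> is increasing for \<open>m \<ge> 1\<close> and \<open>q \<le> 1\<close>.
\<close>

section \<open>Inequalities for real powers\<close>

text \<open>Divided by \<open>x + y\<close>, the numbers \<open>x\<close> and \<open>y\<close>
  become fractions in [0, 1] that sum to 1, and \<open>t \<le> t powr s\<close> on that
  interval.\<close>

lemma powr_add_le:
  fixes x y s :: real
  assumes "0 \<le> x" "0 \<le> y" "0 < s" "s \<le> 1"
  shows "(x + y) powr s \<le> x powr s + y powr s"
proof (cases "x + y = 0")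
  case False
  then have pos: "0 < x + y" using assms by linarith
  have le: "a / (x + y) \<le> (a / (x + y)) powr s" if "0 \<le> a" "a \<le> x + y" for a
  proof (cases "a = 0")
    case False
    then have "(a / (x + y)) powr 1 \<le> (a / (x + y)) powr s"
      using that pos assms by (intro powr_mono') auto
    then show ?thesis using that pos by simp
  qed simp
  have "1 = x / (x + y) + y / (x + y)" using pos by (simp add: add_divide_distrib[symmetric])
  also have "\<dots> \<le> (x / (x + y)) powr s + (y / (x + y)) powr s"
    using le[of x] le[of y] assms by simp
  also have "\<dots> = (x powr s + y powr s) / (x + y) powr s"
    using assms pos by (simp add: powr_divide add_divide_distrib)
  finally show ?thesis using pos by (simp add: field_simps)
qed (use assms in auto)

text \<open>For \<open>u > 0\<close> the derivative
  \<open>m * (1 + u) powr (m - 1) - m * u powr (m - 1)\<close> is nonnegative. The derivative rule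
  for \<open>powr\<close> wants a positive base, so \<open>u = 0\<close> is separate: there the
  claim is superadditivity, obtained from \<open>powr_add_le\<close> with exponent
  \<open>1 / m\<close> at 1 and \<open>v powr m\<close>.\<close>

lemma powr_increment_mono:
  fixes u v m :: real
  assumes "0 \<le> u" "u \<le> v" "1 \<le> m"
  shows "(1 + u) powr m - u powr m \<le> (1 + v) powr m - v powr m"
proof (cases "u = 0")
  case True
  have "(1 + v powr m) powr (1 / m) \<le> 1 powr (1 / m) + (v powr m) powr (1 / m)"
    using assms by (intro powr_add_le) auto
  also have "\<dots> = 1 + v" using assms True by (simp add: powr_powr)
  finally have "((1 + v powr m) powr (1 / m)) powr m \<le> (1 + v) powr m"
    using assms by (intro powr_mono2) auto
  moreover have "((1 + v powr m) powr (1 / m)) powr m = 1 + v powr m"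
    using assms by (simp add: powr_powr add_nonneg_nonneg)
  ultimately show ?thesis using True assms by simp
next
  case False
  show ?thesis
  proof (rule DERIV_nonneg_imp_nondecreasing[OF assms(2)])
    fix x assume x: "u \<le> x" "x \<le> v"
    then have "x > 0" using False assms by simp
    then have "((\<lambda>u. (1 + u) powr m - u powr m) has_real_derivative
        m * (1 + x) powr (m - 1) - m * x powr (m - 1)) (at x)"
      by (auto intro!: derivative_eq_intros)
    moreover have "x powr (m - 1) \<le> (1 + x) powr (m - 1)"
      using \<open>x > 0\<close> assms by (intro powr_mono2) auto
    ultimately show "\<exists>y. ((\<lambda>u. (1 + u) powr m - u powr m) has_real_derivative y) (at x) \<and> 0 \<le> y"
      using assms by (intro exI[of _ "m * (1 + x) powr (m - 1) - m * x powr (m - 1)"])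
        (auto intro!: mult_left_mono)
  qed
qed

text \<open>Subadditivity gives \<open>z powr s \<le> x powr s + y powr s\<close>. After division by
  \<open>y powr \<beta>\<close> only the ratio \<open>u\<close> is left, and the claim compares
  \<open>(1 + u) powr m - q powr m * u powr m\<close> at \<open>u\<close> with its value at
  \<open>1 / k\<close>.\<close>

lemma weighted_powr_bound:
  fixes x y z k q s \<beta> :: real
  assumes nn: "0 \<le> x" "0 \<le> y" "0 \<le> z" and z: "z \<le> x + y"
    and k: "1 \<le> k" and q: "0 < q" "q \<le> 1" and s: "0 < s" "s \<le> 1" and b: "s \<le> \<beta>"
    and kx: "k * x powr s \<le> y powr s"
  shows "z powr \<beta> \<le> q powr (\<beta> / s) * x powr \<beta>
           + ((1 + k) powr (\<beta> / s) - q powr (\<beta> / s)) / k powr (\<beta> / s) * y powr \<beta>"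
proof (cases "y = 0")
  case True
  then have "x powr s \<le> 0" using kx k by (simp add: mult_le_0_iff)
  then have "x = 0" by simp
  then show ?thesis using True z nn by simp
next
  case False
  define m where "m = \<beta> / s"
  define u where "u = x powr s / y powr s"
  have m: "1 \<le> m" using s b by (simp add: m_def)
  have sm: "w powr \<beta> = (w powr s) powr m" for w using s by (simp add: m_def powr_powr)
  have Y: "0 < y powr s" using False nn by simp
  have u: "0 \<le> u" "u \<le> 1 / k" using k kx Y by (simp_all add: u_def field_simps)
  have x: "x powr s = u * y powr s" using Y by (simp add: u_def)
  have "z powr s \<le> x powr s + y powr s"
    using powr_mono2[of s z "x + y"] powr_add_le[of x y s] nn z s by linarith
  then have "z powr \<beta> \<le> ((1 + u) * y powr s) powr m"
    unfolding sm using m by (intro powr_mono2) (auto simp: x algebra_simps)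
  also have "\<dots> = (1 + u) powr m * y powr \<beta>" using u Y by (simp add: sm powr_mult)
  also have "\<dots> \<le> (q powr m * u powr m + ((1 + k) powr m - q powr m) / k powr m) * y powr \<beta>"
  proof (rule mult_right_mono)
    \<comment> \<open>The increasing function is split into \<open>(1 + u) powr m - u powr m\<close>
      and \<open>(1 - q powr m) * u powr m\<close>; the two facts are the monotonicity of each
      summand between \<open>u\<close> and \<open>1 / k\<close>.\<close>
    have "(1 + u) powr m - u powr m \<le> (1 + 1 / k) powr m - (1 / k) powr m"
      using u m by (intro powr_increment_mono) auto
    moreover have "q powr m * ((1 / k) powr m - u powr m) \<le> 1 * ((1 / k) powr m - u powr m)"
      using u m q powr_mono2[of m u "1 / k"] powr_le1[of m q] by (intro mult_right_mono) auto
    ultimately have "(1 + u) powr m \<le> q powr m * u powr m + ((1 + 1 / k) powr m - q powr m * (1 / k) powr m)"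
      by (simp add: algebra_simps)
    also have "(1 + 1 / k) = (1 + k) / k" using k by (simp add: field_simps)
    finally show "(1 + u) powr m \<le> q powr m * u powr m + ((1 + k) powr m - q powr m) / k powr m"
      using k by (simp add: powr_divide diff_divide_distrib)
  qed simp
  also have "\<dots> = q powr m * x powr \<beta> + ((1 + k) powr m - q powr m) / k powr m * y powr \<beta>"
    using u Y by (simp add: sm x powr_mult algebra_simps)
  finally show ?thesis by (simp add: m_def)
qed

section \<open>Measuring a qubit\<close>

text \<open>The columns of the \<open>r\<close> by \<open>n\<close> matrix \<open>U\<close> are
  orthonormal, so its rows \<open>U m\<close> resolve the identity and serve as the outcomes of a
  rank-one measurement. For \<open>r = n\<close> they form an orthonormal basis.\<close>

definition isometry :: "nat \<Rightarrow> nat \<Rightarrow> (nat \<Rightarrow> nat \<Rightarrow> complex) \<Rightarrow> bool" where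
  "isometry r n U \<longleftrightarrow> (\<forall>i<n. \<forall>j<n. (\<Sum>m<r. cnj (U m i) * U m j) = (if i = j then 1 else 0))"

abbreviation sqnorm :: "'i set \<Rightarrow> ('i \<Rightarrow> complex) \<Rightarrow> real" where
  "sqnorm I f \<equiv> (\<Sum>i\<in>I. (cmod (f i))\<^sup>2)"

lemma all_less_two: "(\<forall>i<2. P i) \<longleftrightarrow> P 0 \<and> P (1::nat)"
  by (auto simp: less_2_cases_iff)

lemma sum_less_two: "(\<Sum>i<(2::nat). f i) = f 0 + (f 1 :: 'a :: comm_monoid_add)"
  by (simp add: numeral_2_eq_2)

text \<open>In the following lemmas \<open>p\<close> and \<open>q\<close> are the diagonal entries and \<open>r\<close> is the off-diagonal
  entry of a symmetric 2x2 form with values in \<open>\<complex>\<^sup>I\<close>. A quarter turn of the rotation, respectively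
  a half turn of the phase, exchanges the two basis vectors, hence the intermediate value theorem applies.\<close>

lemma vector_form_equal_diagonal:
  fixes p q r :: "'i \<Rightarrow> complex"
  obtains c s :: real where "c\<^sup>2 + s\<^sup>2 = 1"
    "sqnorm I (\<lambda>i. c\<^sup>2 * p i + 2 * c * s * r i + s\<^sup>2 * q i)
      = sqnorm I (\<lambda>i. s\<^sup>2 * p i - 2 * c * s * r i + c\<^sup>2 * q i)"
proof -
  define f where "f t = 
    sqnorm I (\<lambda>i. (cos t)\<^sup>2 * p i + 2 * cos t * sin t * r i + (sin t)\<^sup>2 * q i)
      - sqnorm I (\<lambda>i. (sin t)\<^sup>2 * p i - 2 * cos t * sin t * r i + (cos t)\<^sup>2 * q i)" for t :: real
  have cont: "continuous_on {0..pi/2} f" unfolding f_def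
    by (intro continuous_intros)
  have 0: "f 0 = sqnorm I p - sqnorm I q" "f (pi/2) = sqnorm I q - sqnorm I p"
    by (simp_all add: f_def)
  have "\<exists>t. f t = 0"
  proof (cases "f 0 \<le> 0")
    case True
    then show ?thesis using IVT'[of f 0 0 "pi/2"] cont 0 by fastforce
  next
    case False
    then show ?thesis using IVT2'[of f "pi/2" 0 0] cont 0 by fastforce
  qed
  then obtain t where "f t = 0" by blast
  then show ?thesis by (intro that[of "cos t" "sin t"]) (auto simp: f_def)
qed

lemma vector_form_equal_phase:
  fixes p q r :: "'i \<Rightarrow> complex"
  obtains e :: complex where "cmod e = 1"
    "sqnorm I (\<lambda>i. p i + 2 * e * r i + e\<^sup>2 * q i) = sqnorm I (\<lambda>i. p i - 2 * e * r i + e\<^sup>2 * q i)"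
proof -
  define f where "f t = sqnorm I (\<lambda>i. p i + 2 * cis t * r i + (cis t)\<^sup>2 * q i)
    - sqnorm I (\<lambda>i. p i - 2 * cis t * r i + (cis t)\<^sup>2 * q i)" for t :: real
  have cont: "continuous_on {0..pi} f" unfolding f_def
    by (intro continuous_intros)
  have 0: "f pi = - f 0" by (simp add: f_def)
  have "\<exists>t. f t = 0"
  proof (cases "f 0 \<le> 0")
    case True
    then show ?thesis using IVT'[of f 0 0 "pi"] cont 0 by fastforce
  next
    case False
    then show ?thesis using IVT2'[of f "pi" 0 0] cont 0 by fastforce
  qed
  then obtain t where "f t = 0" by blast
  then show ?thesis by (intro that[of "cis t"]) (auto simp: f_def)
qed

text \<open>For \<open>a = b\<close> the sum \<open>sqrt a + sqrt b\<close> equals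
  \<open>sqrt (2 * (a + b))\<close>, the largest value it can have for a given \<open>a + b\<close>.
  This is why diagonal entries of equal length are sought.\<close>

lemma sqrt_double_of_equal:
  fixes a b :: real
  assumes "a = b" "c \<le> 2 * (a + b)" "0 \<le> a"
  shows "sqrt c \<le> sqrt a + sqrt b"
proof -
  have "sqrt c \<le> sqrt (4 * a)" using assms by simp
  also have "\<dots> = sqrt a + sqrt b" using assms by (simp add: real_sqrt_mult)
  finally show ?thesis .
qed

text \<open>If the off-diagonal part is at most half of the total, the given basis already suffices
  by \<open>sqrt_double_of_equal\<close>. Otherwise a basis unbiased to it does, since its diagonal
  entries pick up \<open>r\<close>.\<close>

lemma vector_form_equal_case:
  fixes p q r :: "'i \<Rightarrow> complex"
  assumes "sqnorm I p = sqnorm I q"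
  obtains w where "isometry 2 2 w"
    "sqrt (sqnorm I p + sqnorm I q + 2 * sqnorm I r)
      \<le> (\<Sum>m<2. sqrt (sqnorm I (\<lambda>i. (w m 0)\<^sup>2 * p i + 2 * w m 0 * w m 1 * r i + (w m 1)\<^sup>2 * q i)))"
proof (cases "2 * sqnorm I r \<le> sqnorm I p + sqnorm I q")
  case True
  show ?thesis
  proof (rule that[of "\<lambda>m i. if m = i then 1 else 0"])
    show "isometry 2 2 (\<lambda>m i. if m = i then 1 else 0)"
      by (simp add: isometry_def all_less_two sum_less_two)
    show "sqrt (sqnorm I p + sqnorm I q + 2 * sqnorm I r) \<le> (\<Sum>m<2::nat. sqrt (sqnorm I (\<lambda>i.
      (if m = 0 then 1 else 0)\<^sup>2 * p i + 2 * (if m = 0 then 1 else 0) * (if m = 1 then 1 else 0) * r i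
      + (if m = 1 then 1 else 0)\<^sup>2 * q i)))"
      using True sqrt_double_of_equal[OF assms, of "sqnorm I p + sqnorm I q + 2 * sqnorm I r"]
      by (simp add: sum_less_two sum_nonneg)
  qed
next
  case False
  obtain e :: complex where e: "cmod e = 1" and eq:
    "sqnorm I (\<lambda>i. p i + 2 * e * r i + e\<^sup>2 * q i) = sqnorm I (\<lambda>i. p i - 2 * e * r i + e\<^sup>2 * q i)"
    by (rule vector_form_equal_phase[where I = I and p = p and r = r and q = q])
  \<comment> \<open>The vectors \<open>(1, e)\<close> and \<open>(1, - e)\<close> over
    \<open>sqrt 2\<close>; the phase \<open>e\<close> was chosen so that the two new diagonal
    entries have equal length.\<close>
  define w where "w m i = (if i = 0 then 1 else if m = 0 then e else - e) / complex_of_real (sqrt 2)" for m i :: nat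
  have ee: "e * cnj e = 1" "cnj e * e = 1" using e by (simp_all add: complex_norm_square[symmetric] mult.commute)
  have s2: "complex_of_real (sqrt 2) * complex_of_real (sqrt 2) = 2"
    by (metis of_real_mult of_real_numeral real_sqrt_mult_self abs_numeral)
  have iso: "isometry 2 2 w"
    unfolding isometry_def all_less_two sum_less_two w_def by (simp add: s2 ee)
  have h: "sqnorm I (\<lambda>i. x i / 2) = sqnorm I x / 4" for x :: "'i \<Rightarrow> complex"
    by (simp add: norm_divide power_divide sum_divide_distrib)
  have w0: "(w 0 0)\<^sup>2 * p i + 2 * w 0 0 * w 0 1 * r i + (w 0 1)\<^sup>2 * q i = (p i + 2 * e * r i + e\<^sup>2 * q i) / 2"
    and w1: "(w 1 0)\<^sup>2 * p i + 2 * w 1 0 * w 1 1 * r i + (w 1 1)\<^sup>2 * q i = (p i - 2 * e * r i + e\<^sup>2 * q i) / 2" for i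
    by (simp_all add: w_def power2_eq_square s2 add_divide_distrib diff_divide_distrib)
  \<comment> \<open>The parallelogram law, used with \<open>a = p i + e\<^sup>2 * q i\<close> and
    \<open>b = r i\<close>: the two new squared lengths sum to at least
    \<open>2 * sqnorm I r\<close>.\<close>
  have par: "8 * (cmod b)\<^sup>2 \<le> (cmod (a + 2 * e * b))\<^sup>2 + (cmod (a - 2 * e * b))\<^sup>2" for a b
  proof -
    have "(cmod (2 * e * b))\<^sup>2 = 4 * (cmod b)\<^sup>2" using e by (simp add: norm_mult power_mult_distrib)
    moreover have "(cmod (a + c))\<^sup>2 + (cmod (a - c))\<^sup>2 = 2 * (cmod a)\<^sup>2 + 2 * (cmod c)\<^sup>2" for c
      unfolding cmod_power2 by (simp add: power2_eq_square algebra_simps)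
    ultimately show ?thesis by simp
  qed
  have "8 * (cmod (r i))\<^sup>2 \<le> (cmod (p i + 2 * e * r i + e\<^sup>2 * q i))\<^sup>2 + (cmod (p i - 2 * e * r i + e\<^sup>2 * q i))\<^sup>2" for i
    using par[of "r i" "p i + e\<^sup>2 * q i"] by (simp add: algebra_simps)
  then have "(\<Sum>i\<in>I. 8 * (cmod (r i))\<^sup>2) \<le> sqnorm I (\<lambda>i. p i + 2 * e * r i + e\<^sup>2 * q i) + sqnorm I (\<lambda>i. p i - 2 * e * r i + e\<^sup>2 * q i)"
    unfolding sum.distrib[symmetric] by (intro sum_mono) auto
  then have le: "8 * sqnorm I r \<le> sqnorm I (\<lambda>i. p i + 2 * e * r i + e\<^sup>2 * q i) + sqnorm I (\<lambda>i. p i - 2 * e * r i + e\<^sup>2 * q i)"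
    by (simp add: sum_distrib_left)
  show ?thesis
  proof (rule that[OF iso])
    show "sqrt (sqnorm I p + sqnorm I q + 2 * sqnorm I r)
      \<le> (\<Sum>m<2. sqrt (sqnorm I (\<lambda>i. (w m 0)\<^sup>2 * p i + 2 * w m 0 * w m 1 * r i + (w m 1)\<^sup>2 * q i)))"
      unfolding sum_less_two w0 w1 h
      by (rule sqrt_double_of_equal) (use eq le False in \<open>auto simp: sum_nonneg\<close>)
  qed
qed

text \<open>A real rotation makes the diagonal entries equally long and preserves the Frobenius norm
  under the root on the left, so the previous lemma applies in the rotated basis.\<close>

lemma vector_form_orthonormal_bound:
  fixes p q r :: "'i \<Rightarrow> complex"
  obtains w where "isometry 2 2 w"
    "sqrt (sqnorm I p + sqnorm I q + 2 * sqnorm I r)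
      \<le> (\<Sum>m<2. sqrt (sqnorm I (\<lambda>i. (w m 0)\<^sup>2 * p i + 2 * w m 0 * w m 1 * r i + (w m 1)\<^sup>2 * q i)))"
proof -
  obtain c s :: real where cs: "c\<^sup>2 + s\<^sup>2 = 1" and eq:
    "sqnorm I (\<lambda>i. c\<^sup>2 * p i + 2 * c * s * r i + s\<^sup>2 * q i)
      = sqnorm I (\<lambda>i. s\<^sup>2 * p i - 2 * c * s * r i + c\<^sup>2 * q i)"
    by (rule vector_form_equal_diagonal[where I = I and p = p and r = r and q = q])
  \<comment> \<open>The entries of the form in the basis \<open>(c, s)\<close>,
    \<open>(- s, c)\<close>.\<close>
  define p' q' r' where "p' i = c\<^sup>2 * p i + 2 * c * s * r i + s\<^sup>2 * q i"
    and "q' i = s\<^sup>2 * p i - 2 * c * s * r i + c\<^sup>2 * q i"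
    and "r' i = c * s * (q i - p i) + (c\<^sup>2 - s\<^sup>2) * r i" for i
  obtain w where w: "isometry 2 2 w" and le:
    "sqrt (sqnorm I p' + sqnorm I q' + 2 * sqnorm I r')
      \<le> (\<Sum>m<2. sqrt (sqnorm I (\<lambda>i. (w m 0)\<^sup>2 * p' i + 2 * w m 0 * w m 1 * r' i + (w m 1)\<^sup>2 * q' i)))"
    using vector_form_equal_case[where I = I and p = p' and q = q' and r = r'] eq by (auto simp: p'_def q'_def)
  \<comment> \<open>Invariance of the Frobenius norm for a real scalar form; it is applied to the
    real and imaginary part of each coordinate.\<close>
  have rot: "(c\<^sup>2 * x + 2 * c * s * z + s\<^sup>2 * y)\<^sup>2 + (s\<^sup>2 * x - 2 * c * s * z + c\<^sup>2 * y)\<^sup>2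
      + 2 * (c * s * (y - x) + (c\<^sup>2 - s\<^sup>2) * z)\<^sup>2 = x\<^sup>2 + y\<^sup>2 + 2 * z\<^sup>2" for x y z :: real
  proof -
    have "(c\<^sup>2 * x + 2 * c * s * z + s\<^sup>2 * y)\<^sup>2 + (s\<^sup>2 * x - 2 * c * s * z + c\<^sup>2 * y)\<^sup>2
      + 2 * (c * s * (y - x) + (c\<^sup>2 - s\<^sup>2) * z)\<^sup>2 = (c\<^sup>2 + s\<^sup>2)\<^sup>2 * (x\<^sup>2 + y\<^sup>2 + 2 * z\<^sup>2)"
      by (simp add: power2_eq_square algebra_simps)
    then show ?thesis by (simp add: cs)
  qed
  have pw: "(cmod (p' i))\<^sup>2 + (cmod (q' i))\<^sup>2 + 2 * (cmod (r' i))\<^sup>2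
      = (cmod (p i))\<^sup>2 + (cmod (q i))\<^sup>2 + 2 * (cmod (r i))\<^sup>2" for i
  proof -
    have re: "Re (p' i) = c\<^sup>2 * Re (p i) + 2 * c * s * Re (r i) + s\<^sup>2 * Re (q i)"
      "Re (q' i) = s\<^sup>2 * Re (p i) - 2 * c * s * Re (r i) + c\<^sup>2 * Re (q i)"
      "Re (r' i) = c * s * (Re (q i) - Re (p i)) + (c\<^sup>2 - s\<^sup>2) * Re (r i)"
      by (simp_all add: p'_def q'_def r'_def flip: of_real_power of_real_diff)
    have im: "Im (p' i) = c\<^sup>2 * Im (p i) + 2 * c * s * Im (r i) + s\<^sup>2 * Im (q i)"
      "Im (q' i) = s\<^sup>2 * Im (p i) - 2 * c * s * Im (r i) + c\<^sup>2 * Im (q i)"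
      "Im (r' i) = c * s * (Im (q i) - Im (p i)) + (c\<^sup>2 - s\<^sup>2) * Im (r i)"
      by (simp_all add: p'_def q'_def r'_def flip: of_real_power of_real_diff)
    show ?thesis
      using rot[of "Re (p i)" "Re (r i)" "Re (q i)"] rot[of "Im (p i)" "Im (r i)" "Im (q i)"]
      unfolding cmod_power2 re im distrib_left[of 2] by linarith
  qed
  have tot: "sqnorm I p' + sqnorm I q' + 2 * sqnorm I r' = sqnorm I p + sqnorm I q + 2 * sqnorm I r"
    unfolding sum_distrib_left sum.distrib[symmetric] by (simp add: pw sum_distrib_left)
  \<comment> \<open>The rows of \<open>w\<close> written in the original basis. Below,
    \<open>g\<close> is the Gram matrix of the columns of \<open>w\<close>, and \<open>h\<close>
    expresses that of \<open>v\<close> through it.\<close>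
  define v where "v m i = (if i = 0 then c * w m 0 - s * w m 1 else s * w m 0 + c * w m 1)" for m i :: nat
  have form: "(w m 0)\<^sup>2 * p' i + 2 * w m 0 * w m 1 * r' i + (w m 1)\<^sup>2 * q' i
     = (v m 0)\<^sup>2 * p i + 2 * v m 0 * v m 1 * r i + (v m 1)\<^sup>2 * q i" for m i
    by (simp add: v_def p'_def q'_def r'_def power2_eq_square algebra_simps)
  have cs': "complex_of_real c * complex_of_real c + complex_of_real s * complex_of_real s = 1"
    using cs by (metis of_real_1 of_real_add of_real_mult power2_eq_square)
  define g where "g i j = cnj (w 0 i) * w 0 j + cnj (w 1 i) * w 1 j" for i j
  have g: "g 0 0 = 1" "g 0 1 = 0" "g 1 0 = 0" "g 1 1 = 1"
    using w unfolding isometry_def all_less_two sum_less_two g_def by auto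
  have h: "cnj (v 0 0) * v 0 0 + cnj (v 1 0) * v 1 0 = c * c * g 0 0 - c * s * (g 0 1 + g 1 0) + s * s * g 1 1"
    "cnj (v 0 0) * v 0 1 + cnj (v 1 0) * v 1 1 = c * s * (g 0 0 - g 1 1) + c * c * g 0 1 - s * s * g 1 0"
    "cnj (v 0 1) * v 0 0 + cnj (v 1 1) * v 1 0 = c * s * (g 0 0 - g 1 1) + c * c * g 1 0 - s * s * g 0 1"
    "cnj (v 0 1) * v 0 1 + cnj (v 1 1) * v 1 1 = s * s * g 0 0 + c * s * (g 0 1 + g 1 0) + c * c * g 1 1"
    by (simp_all add: v_def g_def algebra_simps)
  have "isometry 2 2 v"
    using cs' unfolding isometry_def all_less_two sum_less_two h g by (simp add: add.commute)
  then show ?thesis using that[of v] le unfolding tot form by blast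
qed

section \<open>Takagi bases of complex symmetric forms\<close>

abbreviation bil :: "nat \<Rightarrow> (nat \<Rightarrow> nat \<Rightarrow> complex) \<Rightarrow> (nat \<Rightarrow> complex) \<Rightarrow> (nat \<Rightarrow> complex) \<Rightarrow> complex" where
  "bil n T x y \<equiv> (\<Sum>i<n. \<Sum>j<n. x i * y j * T i j)"

lemma times_if_one: "x * (if P then 1 else 0) = (if P then x else (0 :: 'a :: semiring_1))"
  and if_one_times: "(if P then 1 else 0) * x = (if P then x else (0 :: 'a :: semiring_1))"
  by auto

lemma of_real_sqnorm: "complex_of_real (sqnorm I f) = (\<Sum>i\<in>I. f i * cnj (f i))"
  by (simp only: of_real_sum complex_norm_square)

lemma isometry_inner:
  assumes "isometry r n U"
  shows "(\<Sum>m<r. cnj (\<Sum>i<n. U m i * x i) * (\<Sum>j<n. U m j * y j)) = (\<Sum>i<n. cnj (x i) * y i)"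
proof -
  have "(\<Sum>m<r. cnj (\<Sum>i<n. U m i * x i) * (\<Sum>j<n. U m j * y j))
      = (\<Sum>m<r. \<Sum>i<n. \<Sum>j<n. cnj (x i) * y j * (cnj (U m i) * U m j))"
    unfolding cnj_sum complex_cnj_mult sum_product by (intro sum.cong refl) (simp add: mult_ac)
  also have "\<dots> = (\<Sum>i<n. \<Sum>j<n. \<Sum>m<r. cnj (x i) * y j * (cnj (U m i) * U m j))"
    by (subst sum.swap, rule sum.cong[OF refl], rule sum.swap)
  also have "\<dots> = (\<Sum>i<n. \<Sum>j<n. cnj (x i) * y j * (if i = j then 1 else 0))"
    using assms by (simp add: isometry_def flip: sum_distrib_left)
  also have "\<dots> = (\<Sum>i<n. cnj (x i) * y i)"
    by (simp add: times_if_one)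
  finally show ?thesis .
qed

lemma isometry_sqnorm:
  assumes "isometry r n U"
  shows "sqnorm {..<r} (\<lambda>m. \<Sum>i<n. U m i * z i) = sqnorm {..<n} z"
proof -
  have "complex_of_real (sqnorm {..<r} (\<lambda>m. \<Sum>i<n. U m i * z i)) = complex_of_real (sqnorm {..<n} z)"
    using isometry_inner[OF assms, of z z] by (simp only: of_real_sqnorm mult.commute)
  then show ?thesis using of_real_eq_iff by blast
qed

text \<open>\<open>isometry_sqnorm\<close> is applied to the two indices of \<open>T\<close> one
  after the other.\<close>

lemma isometry_frobenius:
  assumes "isometry r n U"
  shows "(\<Sum>m<r. \<Sum>l<r. (cmod (bil n T (U m) (U l)))\<^sup>2) = (\<Sum>i<n. \<Sum>j<n. (cmod (T i j))\<^sup>2)"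
proof -
  have "bil n T (U m) (U l) = (\<Sum>i<n. U m i * (\<Sum>j<n. U l j * T i j))" for m l
    by (simp add: sum_distrib_left mult_ac)
  then have "(\<Sum>m<r. \<Sum>l<r. (cmod (bil n T (U m) (U l)))\<^sup>2)
      = (\<Sum>l<r. sqnorm {..<r} (\<lambda>m. \<Sum>i<n. U m i * (\<Sum>j<n. U l j * T i j)))"
    by (simp only:) (rule sum.swap)
  also have "\<dots> = (\<Sum>l<r. \<Sum>i<n. (cmod (\<Sum>j<n. U l j * T i j))\<^sup>2)"
    by (simp only: isometry_sqnorm[OF assms])
  also have "\<dots> = (\<Sum>i<n. sqnorm {..<r} (\<lambda>l. \<Sum>j<n. U l j * T i j))"
    by (rule sum.swap)
  also have "\<dots> = (\<Sum>i<n. \<Sum>j<n. (cmod (T i j))\<^sup>2)"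
    by (simp only: isometry_sqnorm[OF assms])
  finally show ?thesis .
qed

lemma complex_eigenvector_exists:
  fixes A :: "nat \<Rightarrow> nat \<Rightarrow> complex"
  assumes "0 < n"
  obtains v l where "\<exists>i<n. v i \<noteq> 0" "\<And>i. i < n \<Longrightarrow> (\<Sum>j<n. A i j * v j) = l * v i"
proof -
  let ?A = "mat n n (\<lambda>(i, j). A i j)"
  have "spectrum ?A \<noteq> {}" using assms by (intro spectrum_non_empty[of _ n]) auto
  then obtain l v where v: "eigenvector ?A v l" by (auto simp: spectrum_def eigenvalue_def)
  then have d: "dim_vec v = n" and nz: "v \<noteq> 0\<^sub>v n" and eq: "?A *\<^sub>v v = l \<cdot>\<^sub>v v"
    by (auto simp: eigenvector_def)
  show ?thesis
  proof (rule that[of "\<lambda>i. v $ i" l])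
    show "\<exists>i<n. v $ i \<noteq> 0"
    proof (rule ccontr)
      assume "\<not> ?thesis"
      then have "v = 0\<^sub>v n" using d by (intro eq_vecI) auto
      with nz show False by simp
    qed
    fix i assume i: "i < n"
    have "(?A *\<^sub>v v) $ i = (\<Sum>j<n. A i j * v $ j)"
      using i d by (simp add: scalar_prod_def atLeast0LessThan)
    then show "(\<Sum>j<n. A i j * v $ j) = l * v $ i" using eq i d by simp
  qed
qed

text \<open>If \<open>v\<close> is an eigenvector of \<open>cnj T T\<close> with eigenvalue \<open>\<mu>\<^sup>2\<close>, then \<open>w = cnj (T v) + \<mu> v\<close>
  satisfies \<open>T w = \<mu> cnj w\<close>; if \<open>w\<close> vanishes, then \<open>v\<close> itself satisfies \<open>T v = - \<mu> cnj v\<close>.\<close>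

lemma coneigenvector_exists:
  fixes T :: "nat \<Rightarrow> nat \<Rightarrow> complex"
  assumes "0 < n" and sym: "\<And>i j. i < n \<Longrightarrow> j < n \<Longrightarrow> T i j = T j i"
  obtains v s where "\<exists>i<n. v i \<noteq> 0" "\<And>i. i < n \<Longrightarrow> (\<Sum>j<n. T i j * v j) = s * cnj (v i)"
proof -
  obtain v l where nz: "\<exists>i<n. v i \<noteq> 0"
    and ev: "\<And>i. i < n \<Longrightarrow> (\<Sum>j<n. (\<Sum>k<n. cnj (T i k) * T k j) * v j) = l * v i"
    using complex_eigenvector_exists[OF assms(1), of "\<lambda>i j. \<Sum>k<n. cnj (T i k) * T k j"] by blast
  define y where "y i = (\<Sum>j<n. T i j * v j)" for i
  have ev': "(\<Sum>k<n. cnj (T i k) * y k) = l * v i" if "i < n" for i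
  proof -
    have "(\<Sum>k<n. cnj (T i k) * y k) = (\<Sum>k<n. \<Sum>j<n. cnj (T i k) * T k j * v j)"
      by (simp add: y_def sum_distrib_left mult_ac)
    also have "\<dots> = (\<Sum>j<n. (\<Sum>k<n. cnj (T i k) * T k j) * v j)"
      by (subst sum.swap) (simp add: sum_distrib_right)
    finally show ?thesis using ev[OF that] by simp
  qed
  \<comment> \<open>Pairing the eigenvalue equation with \<open>v\<close> and using the symmetry of
    \<open>T\<close> gives \<open>l\<close> times the squared norm of \<open>v\<close> as the
    squared norm of \<open>y\<close>. Hence \<open>l\<close> is real and nonnegative and has a real
    root \<mu>.\<close>
  have "l * (\<Sum>i<n. v i * cnj (v i)) = (\<Sum>i<n. cnj (v i) * (\<Sum>k<n. cnj (T i k) * y k))"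
    unfolding sum_distrib_left[of l] by (rule sum.cong) (auto simp: ev')
  also have "\<dots> = (\<Sum>k<n. \<Sum>i<n. cnj (v i) * cnj (T i k) * y k)"
    by (subst sum.swap) (simp add: sum_distrib_left mult_ac)
  also have "\<dots> = (\<Sum>k<n. y k * cnj (y k))"
    by (auto simp: y_def sum_distrib_left sum_distrib_right mult_ac sym intro!: sum.cong)
  finally have lv: "l * complex_of_real (sqnorm {..<n} v) = complex_of_real (sqnorm {..<n} y)"
    by (simp only: of_real_sqnorm)
  have pos: "0 < sqnorm {..<n} v"
    using nz by (auto intro!: sum_pos2)
  define \<mu> where "\<mu> = sqrt (sqnorm {..<n} y / sqnorm {..<n} v)"
  have "\<mu>\<^sup>2 = sqnorm {..<n} y / sqnorm {..<n} v"
    unfolding \<mu>_def using pos by (intro real_sqrt_pow2 divide_nonneg_pos sum_nonneg) auto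
  moreover have "l = complex_of_real (sqnorm {..<n} y) / complex_of_real (sqnorm {..<n} v)"
    using lv pos by (simp add: eq_divide_eq del: of_real_sum)
  ultimately have l: "l = complex_of_real \<mu> * complex_of_real \<mu>"
    by (simp only: of_real_divide[symmetric] of_real_mult[symmetric] power2_eq_square)
  show ?thesis
  proof (cases "\<exists>i<n. cnj (y i) + \<mu> * v i \<noteq> 0")
    case True
    show ?thesis
    proof (rule that[OF True, of "complex_of_real \<mu>"])
      fix i assume i: "i < n"
      have "(\<Sum>j<n. T i j * (cnj (y j) + \<mu> * v j)) = cnj (\<Sum>j<n. cnj (T i j) * y j) + \<mu> * y i"
        by (simp add: y_def distrib_left sum.distrib sum_distrib_left mult_ac)
      also have "\<dots> = \<mu> * cnj (cnj (y i) + \<mu> * v i)"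
        unfolding ev'[OF i] by (simp add: l algebra_simps)
      finally show "(\<Sum>j<n. T i j * (cnj (y j) + \<mu> * v j)) = \<mu> * cnj (cnj (y i) + \<mu> * v i)" .
    qed
  next
    case False
    show ?thesis
    proof (rule that[OF nz, of "- complex_of_real \<mu>"])
      fix i assume i: "i < n"
      then have "cnj (y i) = - (\<mu> * v i)" using False by (simp add: eq_neg_iff_add_eq_0)
      then have "y i = cnj (- (\<mu> * v i))" by (metis complex_cnj_cnj)
      then show "(\<Sum>j<n. T i j * v j) = - complex_of_real \<mu> * cnj (v i)" by (simp add: y_def)
    qed
  qed
qed

text \<open>Up to conjugation, \<open>H\<close> is the reflection along \<open>u = v - e_0\<close>.
  Since \<open>v 0\<close> is real, \<open>cnj (u 0)\<close> is \<open>- N / 2\<close>, and this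
  makes the first row equal to \<open>v\<close>. A unitary \<open>H\<close> is needed in both forms:
  orthonormal columns for \<open>isometry\<close>, orthonormal rows for deflation.\<close>

lemma householder:
  fixes v :: "nat \<Rightarrow> complex"
  assumes n: "0 < n" and unit: "sqnorm {..<n} v = 1" and real: "Im (v 0) = 0"
  obtains H where "isometry n n H" "\<And>i. i < n \<Longrightarrow> H 0 i = v i"
    "\<And>m l. m < n \<Longrightarrow> l < n \<Longrightarrow> (\<Sum>i<n. H m i * cnj (H l i)) = (if m = l then 1 else 0)"
proof -
  define \<delta> where "\<delta> i j = (if i = j then 1 else 0 :: complex)" for i j :: nat
  define u where "u i = v i - \<delta> i 0" for i
  define N where "N = (\<Sum>i<n. u i * cnj (u i))"
  \<comment> \<open>If \<open>v\<close> is the first unit vector, then \<open>N = 0\<close>, so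
    \<open>c = 0\<close> by the convention for division and \<open>H\<close> is the
    identity.\<close>
  define c where "c = 2 / N"
  define H where "H m i = \<delta> m i - c * cnj (u m) * u i" for m i
  have vv: "(\<Sum>i<n. v i * cnj (v i)) = 1"
    unfolding of_real_sqnorm[symmetric] unit by simp
  have v0: "cnj (v 0) = v 0" using real by (simp add: complex_eq_iff)
  have \<delta>sum: "(\<Sum>i<n. \<delta> i j * f i) = f j" "(\<Sum>i<n. \<delta> j i * f i) = f j" if "j < n" for f j
    using that by (simp_all add: \<delta>_def if_one_times)
  have "N = (\<Sum>i<n. v i * cnj (v i)) - (\<Sum>i<n. \<delta> i 0 * (v i + cnj (v i))) + (\<Sum>i<n. \<delta> i 0 * 1)"
    unfolding N_def u_def sum_subtractf[symmetric] sum.distrib[symmetric]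
    by (rule sum.cong) (auto simp: \<delta>_def algebra_simps)
  then have N: "N = 2 - 2 * v 0" by (simp only: \<delta>sum[OF n] vv v0) simp
  have Nu: "N = complex_of_real (sqnorm {..<n} u)"
    by (simp only: N_def of_real_sqnorm)
  have cc: "cnj c = c" by (simp add: c_def Nu del: of_real_sum)
  have cN: "c * c * N = 2 * c" by (simp add: c_def)
  have herm: "cnj (H m i) = H i m" for m i
    by (simp add: H_def \<delta>_def cc)
  have prod: "(\<Sum>m<n. H i m * H m j) = \<delta> i j" if "i < n" "j < n" for i j
  proof -
    have "(\<Sum>m<n. H i m * H m j) = (\<Sum>m<n. \<delta> i m * \<delta> m j) - c * cnj (u i) * (\<Sum>m<n. \<delta> m j * u m)
       - c * u j * (\<Sum>m<n. \<delta> i m * cnj (u m)) + c * c * N * cnj (u i) * u j"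
      unfolding H_def N_def sum_distrib_left sum_distrib_right sum_subtractf[symmetric] sum.distrib[symmetric]
      by (rule sum.cong) (auto simp: algebra_simps)
    then show ?thesis by (simp add: \<delta>sum that cN)
  qed
  show ?thesis
  proof (rule that[of H])
    show "isometry n n H" unfolding isometry_def herm using prod by (simp add: \<delta>_def)
    show "(\<Sum>i<n. H m i * cnj (H l i)) = (if m = l then 1 else 0)" if "m < n" "l < n" for m l
      unfolding herm using prod that by (simp add: \<delta>_def)
    fix i assume i: "i < n"
    show "H 0 i = v i"
    proof (cases "N = 0")
      case True
      then have "sqnorm {..<n} u = 0" unfolding Nu of_real_eq_0_iff .
      then have "u i = 0" using i by (simp add: sum_nonneg_eq_0_iff)
      then show ?thesis by (cases "i = 0") (simp_all add: H_def u_def \<delta>_def)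
    next
      case False
      have "cnj (u 0) = - (N / 2)" by (simp add: N u_def \<delta>_def v0 diff_divide_distrib)
      then have "c * cnj (u 0) = -1" using False by (simp add: c_def)
      then have "H 0 i = \<delta> 0 i + u i" by (simp add: H_def)
      then show ?thesis by (cases "i = 0") (simp_all add: u_def \<delta>_def)
    qed
  qed
qed

text \<open>Scaling \<open>v\<close> by \<open>a\<close> replaces \<open>s\<close> by
  \<open>s * a / cnj a\<close>. The modulus of \<open>a\<close> normalises \<open>v\<close>, and its
  phase makes \<open>v 0\<close> real, as \<open>householder\<close> requires.\<close>

lemma coneigenvector_normalized:
  fixes T :: "nat \<Rightarrow> nat \<Rightarrow> complex"
  assumes "0 < n" and sym: "\<And>i j. i < n \<Longrightarrow> j < n \<Longrightarrow> T i j = T j i"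
  obtains v s where "sqnorm {..<n} v = 1" "Im (v 0) = 0"
    "\<And>i. i < n \<Longrightarrow> (\<Sum>j<n. T i j * v j) = s * cnj (v i)"
proof -
  obtain v s where nz: "\<exists>i<n. v i \<noteq> 0"
    and ev: "\<And>i. i < n \<Longrightarrow> (\<Sum>j<n. T i j * v j) = s * cnj (v i)"
    by (rule coneigenvector_exists[OF assms(1), of T]) (use sym in auto)
  have pos: "0 < sqnorm {..<n} v"
    using nz by (auto intro!: sum_pos2)
  define a where "a = (if v 0 = 0 then 1 else cnj (v 0) / cmod (v 0)) / sqrt (sqnorm {..<n} v)"
  have a: "(cmod a)\<^sup>2 = 1 / sqnorm {..<n} v"
    using pos by (simp add: a_def norm_divide power_divide)
  then have a0: "a \<noteq> 0" using pos by auto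
  show ?thesis
  proof (rule that[of "\<lambda>i. a * v i" "s * a / cnj a"])
    show "sqnorm {..<n} (\<lambda>i. a * v i) = 1"
      using a pos by (simp add: norm_mult power_mult_distrib flip: sum_divide_distrib)
    have "v 0 * cnj (v 0) = complex_of_real (cmod (v 0)) * complex_of_real (cmod (v 0))"
      by (simp only: complex_norm_square[symmetric] power2_eq_square of_real_mult)
    then have "a * v 0 = complex_of_real (cmod (v 0) / sqrt (sqnorm {..<n} v))"
      by (simp add: a_def mult.commute)
    then show "Im (a * v 0) = 0" by (simp only: Im_complex_of_real)
    fix i assume "i < n"
    have "(\<Sum>j<n. T i j * (a * v j)) = a * (\<Sum>j<n. T i j * v j)"
      by (simp add: sum_distrib_left mult_ac)
    then show "(\<Sum>j<n. T i j * (a * v j)) = s * a / cnj a * cnj (a * v i)"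
      using ev[OF \<open>i < n\<close>] a0 by simp
  qed
qed

lemma bil_sum:
  "bil N T (\<lambda>i. \<Sum>l<n. a l * h l i) (\<lambda>j. \<Sum>l<n. b l * h l j) = bil n (\<lambda>l l'. bil N T (h l) (h l')) a b"
proof -
  have "bil N T (\<lambda>i. \<Sum>l<n. a l * h l i) (\<lambda>j. \<Sum>l<n. b l * h l j)
      = (\<Sum>i<N. \<Sum>j<N. \<Sum>l<n. \<Sum>l'<n. a l * b l' * (h l i * h l' j * T i j))"
    unfolding sum_product unfolding sum_distrib_right by (intro sum.cong refl) (simp add: mult_ac)
  also have "\<dots> = (\<Sum>i<N. \<Sum>l<n. \<Sum>j<N. \<Sum>l'<n. a l * b l' * (h l i * h l' j * T i j))"
    by (rule sum.cong[OF refl], rule sum.swap)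
  also have "\<dots> = (\<Sum>l<n. \<Sum>i<N. \<Sum>l'<n. \<Sum>j<N. a l * b l' * (h l i * h l' j * T i j))"
    by (subst sum.swap, rule sum.cong[OF refl], rule sum.cong[OF refl], rule sum.swap)
  also have "\<dots> = (\<Sum>l<n. \<Sum>l'<n. \<Sum>i<N. \<Sum>j<N. a l * b l' * (h l i * h l' j * T i j))"
    by (rule sum.cong[OF refl], rule sum.swap)
  finally show ?thesis by (simp only: sum_distrib_left)
qed

lemma sum_Suc_Suc_shift:
  fixes F :: "nat \<Rightarrow> nat \<Rightarrow> 'a :: comm_monoid_add"
  shows "(\<Sum>m<Suc n. \<Sum>l<Suc n. F m l)
    = F 0 0 + (\<Sum>l<n. F 0 (Suc l)) + (\<Sum>l<n. F (Suc l) 0) + (\<Sum>l<n. \<Sum>l'<n. F (Suc l) (Suc l'))"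
  by (simp only: sum.lessThan_Suc_shift sum.distrib add_ac)

text \<open>Takagi's factorisation by deflation: a unitary whose first row is a coneigenvector
  splits \<open>T\<close> into a scalar and a smaller symmetric block. The bound is carried along by
  \<open>sqrt (a + b) \<le> sqrt a + sqrt b\<close>.\<close>

lemma symmetric_form_orthonormal_bound:
  assumes "\<And>i j. i < n \<Longrightarrow> j < n \<Longrightarrow> T i j = T j i"
  shows "\<exists>U. isometry n n U \<and> sqrt (\<Sum>i<n. \<Sum>j<n. (cmod (T i j))\<^sup>2) \<le> (\<Sum>m<n. cmod (bil n T (U m) (U m)))"
  using assms
proof (induction n arbitrary: T)
  case 0
  then show ?case by (simp add: isometry_def)
next
  case (Suc n)
  let ?N = "Suc n"
  have sym: "T i j = T j i" if "i < ?N" "j < ?N" for i j using Suc.prems that by blast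
  obtain v s where v: "sqnorm {..<?N} v = 1" "Im (v 0) = 0"
    and ev: "\<And>i. i < ?N \<Longrightarrow> (\<Sum>j<?N. T i j * v j) = s * cnj (v i)"
    by (rule coneigenvector_normalized[of ?N T]) (use sym in auto)
  obtain H where H: "isometry ?N ?N H" and H0: "\<And>i. i < ?N \<Longrightarrow> H 0 i = v i"
    and orth: "\<And>m l. m < ?N \<Longrightarrow> l < ?N \<Longrightarrow> (\<Sum>i<?N. H m i * cnj (H l i)) = (if m = l then 1 else 0)"
    by (rule householder[of ?N v]) (use v in auto)
  define T' where "T' l l' = bil ?N T (H (Suc l)) (H (Suc l'))" for l l'
  have bsym: "bil ?N T x y = bil ?N T y x" for x y
    by (subst sum.swap) (auto intro!: sum.cong simp: sym mult_ac simp del: sum.lessThan_Suc)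
  obtain U where U: "isometry n n U"
    and le: "sqrt (\<Sum>i<n. \<Sum>j<n. (cmod (T' i j))\<^sup>2) \<le> (\<Sum>m<n. cmod (bil n T' (U m) (U m)))"
    using Suc.IH[of T'] bsym unfolding T'_def by blast
  \<comment> \<open>\<open>T\<close> sends \<open>v\<close> to a multiple of \<open>cnj v\<close>,
    so this entry is a multiple of the inner product of two distinct rows of
    \<open>H\<close>.\<close>
  have off: "bil ?N T (H (Suc l)) (H 0) = 0" if "l < n" for l
  proof -
    have "bil ?N T (H (Suc l)) (H 0) = (\<Sum>i<?N. H (Suc l) i * (\<Sum>j<?N. T i j * v j))"
      unfolding sum_distrib_left by (intro sum.cong refl) (auto simp: H0)
    also have "\<dots> = (\<Sum>i<?N. s * (H (Suc l) i * cnj (H 0 i)))"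
      by (intro sum.cong refl) (auto simp: H0 ev simp del: sum.lessThan_Suc)
    also have "\<dots> = s * (\<Sum>i<?N. H (Suc l) i * cnj (H 0 i))"
      by (rule sum_distrib_left[symmetric])
    also have "\<dots> = 0" using orth[of "Suc l" 0] that by (simp del: sum.lessThan_Suc)
    finally show ?thesis .
  qed
  have "(\<Sum>i<?N. \<Sum>j<?N. (cmod (T i j))\<^sup>2) = (\<Sum>m<?N. \<Sum>l<?N. (cmod (bil ?N T (H m) (H l)))\<^sup>2)"
    by (rule isometry_frobenius[OF H, symmetric])
  also have "\<dots> = (cmod (bil ?N T (H 0) (H 0)))\<^sup>2 + (\<Sum>l<n. \<Sum>l'<n. (cmod (T' l l'))\<^sup>2)"
  proof -
    have "(\<Sum>l<n. (cmod (bil ?N T (H 0) (H (Suc l))))\<^sup>2) = 0"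
      "(\<Sum>l<n. (cmod (bil ?N T (H (Suc l)) (H 0)))\<^sup>2) = 0"
      unfolding bsym[of "H 0" "H (Suc _)"] by (intro sum.neutral; simp add: off del: sum.lessThan_Suc)+
    then show ?thesis
      unfolding T'_def sum_Suc_Suc_shift[where F = "\<lambda>m l. (cmod (bil ?N T (H m) (H l)))\<^sup>2"]
      by linarith
  qed
  finally have "sqrt (\<Sum>i<?N. \<Sum>j<?N. (cmod (T i j))\<^sup>2)
      = sqrt ((cmod (bil ?N T (H 0) (H 0)))\<^sup>2 + (\<Sum>l<n. \<Sum>l'<n. (cmod (T' l l'))\<^sup>2))" by (rule arg_cong)
  also have "\<dots> \<le> sqrt ((cmod (bil ?N T (H 0) (H 0)))\<^sup>2) + sqrt (\<Sum>l<n. \<Sum>l'<n. (cmod (T' l l'))\<^sup>2)"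
    by (rule sqrt_add_le_add_sqrt) (auto intro!: sum_nonneg)
  also have "\<dots> \<le> cmod (bil ?N T (H 0) (H 0)) + (\<Sum>m<n. cmod (bil n T' (U m) (U m)))"
    using le by (simp del: sum.lessThan_Suc)
  finally have bound: "sqrt (\<Sum>i<?N. \<Sum>j<?N. (cmod (T i j))\<^sup>2)
      \<le> cmod (bil ?N T (H 0) (H 0)) + (\<Sum>m<n. cmod (bil n T' (U m) (U m)))" .
  \<comment> \<open>The product of \<open>1 \<oplus> U\<close> with \<open>H\<close>.\<close>
  define W where "W m = (if m = 0 then H 0 else (\<lambda>i. \<Sum>l<n. U (m - 1) l * H (Suc l) i))" for m
  have W: "W 0 = H 0" "W (Suc m) = (\<lambda>i. \<Sum>l<n. U m l * H (Suc l) i)" for m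
    by (simp_all add: W_def)
  have iso: "isometry ?N ?N W"
    unfolding isometry_def
  proof (intro allI impI)
    fix i j assume ij: "i < ?N" "j < ?N"
    have "(\<Sum>m<?N. cnj (W m i) * W m j)
        = cnj (H 0 i) * H 0 j + (\<Sum>m<n. cnj (\<Sum>l<n. U m l * H (Suc l) i) * (\<Sum>l<n. U m l * H (Suc l) j))"
      unfolding sum.lessThan_Suc_shift W ..
    also have "\<dots> = (\<Sum>m<?N. cnj (H m i) * H m j)"
      unfolding isometry_inner[OF U] sum.lessThan_Suc_shift ..
    also have "\<dots> = (if i = j then 1 else 0)" using H ij by (simp add: isometry_def del: sum.lessThan_Suc)
    finally show "(\<Sum>m<?N. cnj (W m i) * W m j) = (if i = j then 1 else 0)" .
  qed
  have val: "(\<Sum>m<?N. cmod (bil ?N T (W m) (W m)))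
      = cmod (bil ?N T (H 0) (H 0)) + (\<Sum>m<n. cmod (bil n T' (U m) (U m)))"
    unfolding sum.lessThan_Suc_shift[where g = "\<lambda>m. cmod (bil ?N T (W m) (W m))"] W bil_sum T'_def ..
  show ?case by (intro exI conjI) (rule iso, unfold val, rule bound)
qed

section \<open>Concurrence of tripartite vectors\<close>

text \<open>The concurrence of an unnormalised vector of \<open>\<complex>\<^sup>2 \<otimes> \<complex>\<^sup>d\<close>; it is homogeneous of degree 2, so that
  probabilities can be absorbed into the vectors of an ensemble.\<close>

definition conc :: "nat \<Rightarrow> (nat \<Rightarrow> complex) \<Rightarrow> real" where
  "conc d f = sqrt (2 * (\<Sum>i<d. \<Sum>j<d. (cmod (f i * f (d + j) - f j * f (d + i)))\<^sup>2))"

text \<open>Contraction of the third, respectively the second, factor of \<open>\<complex>\<^sup>2 \<otimes> \<complex>\<^sup>2 \<otimes> \<complex>\<^sup>d\<close> with a vector \<open>u\<close>.\<close>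

definition contract3 :: "nat \<Rightarrow> (nat \<Rightarrow> complex) \<Rightarrow> (nat \<Rightarrow> complex) \<Rightarrow> nat \<Rightarrow> complex" where
  "contract3 d u f i = (\<Sum>c<d. u c * f (i * d + c))"

definition contract2 :: "nat \<Rightarrow> (nat \<Rightarrow> complex) \<Rightarrow> (nat \<Rightarrow> complex) \<Rightarrow> nat \<Rightarrow> complex" where
  "contract2 d u f i = (\<Sum>b<2. u b * f ((i div d) * (2 * d) + b * d + i mod d))"

lemma sum_lessThan_double:
  fixes g :: "nat \<Rightarrow> 'a :: comm_monoid_add"
  shows "(\<Sum>i<2 * d. g i) = (\<Sum>c<d. g c) + (\<Sum>c<d. g (d + c))"
proof -
  have "(\<Sum>i<d + e. g i) = (\<Sum>c<d. g c) + (\<Sum>c<e. g (d + c))" for e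
    by (induction e) (auto simp: add_ac)
  from this[of d] show ?thesis by (simp add: mult_2)
qed

lemma conc_two: "conc 2 g = 2 * cmod (g 0 * g 3 - g 1 * g 2)"
proof -
  have "cmod (g 1 * g 2 - g 0 * g 3) = cmod (g 0 * g 3 - g 1 * g 2)" by (rule norm_minus_commute)
  then have "conc 2 g = sqrt (4 * (cmod (g 0 * g 3 - g 1 * g 2))\<^sup>2)"
    by (simp add: conc_def sum_less_two numeral_2_eq_2 numeral_3_eq_3)
  then show ?thesis by (simp add: real_sqrt_mult)
qed

text \<open>Below, \<open>T\<close> is the component of the bivector in \<open>\<Lambda>\<^sup>2\<complex>\<^sup>2 \<otimes> S\<^sup>2\<complex>\<^sup>d\<close>, and
  \<open>P\<close>, \<open>R\<close> (diagonal) and \<open>S\<close> (off-diagonal) form the component in \<open>S\<^sup>2\<complex>\<^sup>2 \<otimes> \<Lambda>\<^sup>2\<complex>\<^sup>d\<close>.\<close>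

lemma conc_tripartite_le:
  "\<exists>U w. isometry d d U \<and> isometry 2 2 w \<and>
     conc (2 * d) f \<le> (\<Sum>m<d. conc 2 (contract3 d (U m) f)) + (\<Sum>m<2. conc d (contract2 d (w m) f))"
proof -
  \<comment> \<open>The components of \<open>f\<close> at the values 00, 01, 10, 11 of the two
    qubits.\<close>
  define x0 x1 y0 y1 where "x0 c = f c" and "x1 c = f (d + c)"
    and "y0 c = f (2 * d + c)" and "y1 c = f (3 * d + c)" for c
  \<comment> \<open>The minors of the two halves of \<open>f\<close>, sorted by the values of the
    second qubit: both 0 for \<open>P\<close>, both 1 for \<open>R\<close>, mixed for
    \<open>Q\<close>.\<close>
  define P R Q where "P c c' = x0 c * y0 c' - x0 c' * y0 c" and "R c c' = x1 c * y1 c' - x1 c' * y1 c"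
    and "Q c c' = x0 c * y1 c' - x1 c' * y0 c" for c c'
  define T S where "T c c' = (Q c c' + Q c' c) / 2" and "S c c' = (Q c c' - Q c' c) / 2" for c c'
  let ?I = "{..<d} \<times> {..<d}"
  let ?n = "\<lambda>F. sqnorm ?I (\<lambda>(c, c'). F c c')"
  have n: "?n F = (\<Sum>c<d. \<Sum>c'<d. (cmod (F c c'))\<^sup>2)" for F :: "nat \<Rightarrow> nat \<Rightarrow> complex"
    by (simp add: sum.cartesian_product case_prod_unfold)
  have "(cmod (a + b))\<^sup>2 + (cmod (a - b))\<^sup>2 = 2 * (cmod a)\<^sup>2 + 2 * (cmod b)\<^sup>2" for a b
    unfolding cmod_power2 by (simp add: power2_eq_square algebra_simps)
  then have "2 * (cmod (Q c c'))\<^sup>2 + 2 * (cmod (Q c' c))\<^sup>2 = 4 * (cmod (T c c'))\<^sup>2 + 4 * (cmod (S c c'))\<^sup>2" for c c'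
    by (simp add: T_def S_def norm_divide power_divide)
  then have "(\<Sum>c<d. \<Sum>c'<d. 2 * (cmod (Q c c'))\<^sup>2) + (\<Sum>c<d. \<Sum>c'<d. 2 * (cmod (Q c' c))\<^sup>2)
      = (\<Sum>c<d. \<Sum>c'<d. 4 * (cmod (T c c'))\<^sup>2) + (\<Sum>c<d. \<Sum>c'<d. 4 * (cmod (S c c'))\<^sup>2)"
    unfolding sum.distrib[symmetric] by simp
  moreover have swap: "(\<Sum>c<d. \<Sum>c'<d. (cmod (Q c' c))\<^sup>2) = ?n Q" unfolding n by (rule sum.swap)
  ultimately have Q: "?n Q = ?n T + ?n S" unfolding n sum_distrib_left[symmetric] by linarith
  have ineq: "2 * d + (d + c) = 3 * d + c" for c by simp
  have "(conc (2 * d) f)\<^sup>2 = 2 * (\<Sum>i<2 * d. \<Sum>j<2 * d. (cmod (f i * f (2 * d + j) - f j * f (2 * d + i)))\<^sup>2)"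
    unfolding conc_def by (intro real_sqrt_pow2 mult_nonneg_nonneg sum_nonneg) auto
  \<comment> \<open>Splitting both indices by the second qubit gives four blocks; the two mixed ones
    are \<open>Q\<close> and its negative transpose.\<close>
  also have "\<dots> = 2 * ((?n P + ?n Q) + ((\<Sum>c<d. \<Sum>c'<d. (cmod (- Q c' c))\<^sup>2) + ?n R))"
    unfolding n sum_lessThan_double sum.distrib ineq P_def Q_def R_def x0_def x1_def y0_def y1_def
    by (simp add: mult.commute)
  finally have conc: "(conc (2 * d) f)\<^sup>2 = 4 * ?n T + 2 * (?n P + ?n R + 2 * ?n S)"
    by (simp only: norm_minus_cancel swap Q) (simp add: algebra_simps)
  obtain U where U: "isometry d d U"
    and Ule: "sqrt (?n T) \<le> (\<Sum>m<d. cmod (bil d T (U m) (U m)))"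
  proof -
    have "T i j = T j i" for i j by (simp add: T_def add.commute)
    then show ?thesis using symmetric_form_orthonormal_bound[of d T] that unfolding n by blast
  qed
  obtain w where w: "isometry 2 2 w" and wle:
    "sqrt (?n P + ?n R + 2 * ?n S) \<le> (\<Sum>m<2. sqrt (sqnorm ?I (\<lambda>i. (w m 0)\<^sup>2 * (case i of (c, c') \<Rightarrow> P c c')
      + 2 * w m 0 * w m 1 * (case i of (c, c') \<Rightarrow> S c c') + (w m 1)\<^sup>2 * (case i of (c, c') \<Rightarrow> R c c'))))"
    by (rule vector_form_orthonormal_bound)
  have c3: "conc 2 (contract3 d u f) = 2 * cmod (bil d T u u)" for u
  proof -
    \<comment> \<open>The antisymmetric part of \<open>Q\<close> vanishes on \<open>u\<close>,
      \<open>u\<close>, so \<open>T\<close> may be replaced by \<open>Q\<close>, whose value is the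
      determinant of the contracted vector.\<close>
    have "bil d T u u = ((\<Sum>c<d. \<Sum>c'<d. u c * u c' * Q c c') + (\<Sum>c<d. \<Sum>c'<d. u c * u c' * Q c' c)) / 2"
      unfolding sum.distrib[symmetric] sum_divide_distrib T_def by (simp add: algebra_simps add_divide_distrib)
    also have "(\<Sum>c<d. \<Sum>c'<d. u c * u c' * Q c' c) = (\<Sum>c<d. \<Sum>c'<d. u c * u c' * Q c c')"
      by (subst sum.swap) (simp add: mult_ac)
    finally have "bil d T u u = (\<Sum>c<d. \<Sum>c'<d. u c * u c' * Q c c')" by simp
    also have "\<dots> = (\<Sum>c<d. \<Sum>c'<d. (u c * x0 c) * (u c' * y1 c')) - (\<Sum>c<d. \<Sum>c'<d. (u c * y0 c) * (u c' * x1 c'))"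
      unfolding sum_subtractf[symmetric] Q_def by (simp add: algebra_simps)
    also have "\<dots> = (\<Sum>c<d. u c * x0 c) * (\<Sum>c<d. u c * y1 c) - (\<Sum>c<d. u c * x1 c) * (\<Sum>c<d. u c * y0 c)"
      unfolding sum_product[symmetric] by simp
    also have "\<dots> = contract3 d u f 0 * contract3 d u f 3 - contract3 d u f 1 * contract3 d u f 2"
      by (simp add: contract3_def x0_def x1_def y0_def y1_def)
    finally show ?thesis by (simp only: conc_two)
  qed
  \<comment> \<open>Contracting the second qubit with \<open>u\<close> evaluates the vector-valued
    form with entries \<open>P\<close>, \<open>S\<close>, \<open>R\<close> at
    \<open>u\<close>.\<close>
  have c2: "conc d (contract2 d u f) = sqrt 2 * sqrt (sqnorm ?I (\<lambda>i. (u 0)\<^sup>2 * (case i of (c, c') \<Rightarrow> P c c')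
      + 2 * u 0 * u 1 * (case i of (c, c') \<Rightarrow> S c c') + (u 1)\<^sup>2 * (case i of (c, c') \<Rightarrow> R c c')))" for u
  proof -
    have a: "contract2 d u f c = u 0 * x0 c + u 1 * x1 c"
      "contract2 d u f (d + c) = u 0 * y0 c + u 1 * y1 c" if "c < d" for c
    proof -
      have dm: "c div d = 0" "c mod d = c" "(d + c) div d = 1" "(d + c) mod d = c"
        using that by auto
      have idx: "0 * (2 * d) + 0 * d + c = c" "0 * (2 * d) + 1 * d + c = d + c"
        "1 * (2 * d) + 0 * d + c = 2 * d + c" "1 * (2 * d) + 1 * d + c = 3 * d + c" by simp_all
      show "contract2 d u f c = u 0 * x0 c + u 1 * x1 c"
        "contract2 d u f (d + c) = u 0 * y0 c + u 1 * y1 c"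
        unfolding contract2_def sum_less_two dm idx x0_def x1_def y0_def y1_def by (rule refl)+
    qed
    have "contract2 d u f c * contract2 d u f (d + c') - contract2 d u f c' * contract2 d u f (d + c)
        = (u 0)\<^sup>2 * P c c' + 2 * u 0 * u 1 * S c c' + (u 1)\<^sup>2 * R c c'" if "c < d" "c' < d" for c c'
    proof -
      have S2: "2 * u 0 * u 1 * S c c' = u 0 * u 1 * (Q c c' - Q c' c)" by (simp add: S_def)
      show ?thesis
        unfolding a[OF that(1)] a[OF that(2)] S2 P_def R_def Q_def by (simp add: power2_eq_square algebra_simps)
    qed
    then have "(\<Sum>c<d. \<Sum>c'<d. (cmod (contract2 d u f c * contract2 d u f (d + c') - contract2 d u f c' * contract2 d u f (d + c)))\<^sup>2)
      = (\<Sum>c<d. \<Sum>c'<d. (cmod ((u 0)\<^sup>2 * P c c' + 2 * u 0 * u 1 * S c c' + (u 1)\<^sup>2 * R c c'))\<^sup>2)"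
      by (intro sum.cong refl) auto
    also have "\<dots> = sqnorm ?I (\<lambda>i. (u 0)\<^sup>2 * (case i of (c, c') \<Rightarrow> P c c')
      + 2 * u 0 * u 1 * (case i of (c, c') \<Rightarrow> S c c') + (u 1)\<^sup>2 * (case i of (c, c') \<Rightarrow> R c c'))"
      by (simp add: sum.cartesian_product case_prod_unfold)
    finally show ?thesis by (simp only: conc_def real_sqrt_mult)
  qed
  have nn: "0 \<le> ?n F" for F by (rule sum_nonneg) auto
  have "conc (2 * d) f = sqrt ((conc (2 * d) f)\<^sup>2)"
    by (simp add: conc_def sum_nonneg)
  also have "\<dots> \<le> sqrt (4 * ?n T) + sqrt (2 * (?n P + ?n R + 2 * ?n S))"
    unfolding conc by (intro sqrt_add_le_add_sqrt mult_nonneg_nonneg add_nonneg_nonneg nn) auto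
  also have "\<dots> = 2 * sqrt (?n T) + sqrt 2 * sqrt (?n P + ?n R + 2 * ?n S)"
    by (simp only: real_sqrt_mult real_sqrt_four)
  also have "\<dots> \<le> 2 * (\<Sum>m<d. cmod (bil d T (U m) (U m))) + sqrt 2 * (\<Sum>m<2. sqrt (sqnorm ?I (\<lambda>i. (w m 0)\<^sup>2 * (case i of (c, c') \<Rightarrow> P c c')
      + 2 * w m 0 * w m 1 * (case i of (c, c') \<Rightarrow> S c c') + (w m 1)\<^sup>2 * (case i of (c, c') \<Rightarrow> R c c'))))"
    by (intro add_mono mult_left_mono Ule wle) auto
  also have "\<dots> = (\<Sum>m<d. conc 2 (contract3 d (U m) f)) + (\<Sum>m<2. conc d (contract2 d (w m) f))"
    by (simp only: c2 c3 sum_distrib_left)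
  finally show ?thesis using U w by blast
qed

section \<open>The negativity of a pure state with a qubit\<close>

definition herm2 :: "real \<Rightarrow> real \<Rightarrow> complex \<Rightarrow> complex mat" where
  "herm2 p q r = mat 2 2 (\<lambda>(i, j).
     if i = 0 then (if j = 0 then complex_of_real p else r) else (if j = 0 then cnj r else complex_of_real q))"

lemma herm2_index:
  "herm2 p q r \<in> carrier_mat 2 2" "herm2 p q r $$ (0, 0) = complex_of_real p" "herm2 p q r $$ (0, 1) = r"
  "herm2 p q r $$ (1, 0) = cnj r" "herm2 p q r $$ (1, 1) = complex_of_real q"
  by (simp_all add: herm2_def)

lemma mat_two_eqI:
  assumes "A \<in> carrier_mat 2 2" "B \<in> carrier_mat 2 2"
    "A $$ (0, 0) = B $$ (0, 0)" "A $$ (0, 1) = B $$ (0, 1)" "A $$ (1, 0) = B $$ (1, 0)" "A $$ (1, 1) = B $$ (1, 1)"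
  shows "A = B"
  using assms by (intro eq_matI) (auto simp: less_2_cases_iff)

lemma herm2_square: "herm2 p q r * herm2 p q r = herm2 (p\<^sup>2 + (cmod r)\<^sup>2) (q\<^sup>2 + (cmod r)\<^sup>2) (r * (p + q))"
proof -
  have c: "herm2 p q r \<in> carrier_mat 2 2" by (rule herm2_index)
  have e: "(herm2 p q r * herm2 p q r) $$ (i, j)
      = herm2 p q r $$ (i, 0) * herm2 p q r $$ (0, j) + herm2 p q r $$ (i, 1) * herm2 p q r $$ (1, j)"
    if "i < 2" "j < 2" for i j
    using that c by (simp add: scalar_prod_def numeral_2_eq_2)
  have r: "r * cnj r = complex_of_real ((cmod r)\<^sup>2)" by (rule complex_norm_square[symmetric])
  have r': "cnj r * r = complex_of_real ((cmod r)\<^sup>2)" using r by (simp only: mult.commute)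
  have lt: "(0::nat) < 2" "(1::nat) < 2" by simp_all
  have h: "herm2 x y w \<in> carrier_mat 2 2" for x y w by (rule herm2_index)
  show ?thesis
  proof (rule mat_two_eqI[OF _ h])
    show "herm2 p q r * herm2 p q r \<in> carrier_mat 2 2" by (rule mult_carrier_mat[OF c c])
  qed (unfold e[OF lt(1) lt(1)] e[OF lt(1) lt(2)] e[OF lt(2) lt(1)] e[OF lt(2) lt(2)] herm2_index r r',
      simp_all add: power2_eq_square algebra_simps)
qed

lemma quad_form_herm2:
  assumes "v \<in> carrier_vec 2"
  shows "quad_form 2 (herm2 p q r) v
    = complex_of_real (p * (cmod (v $ 0))\<^sup>2 + q * (cmod (v $ 1))\<^sup>2 + 2 * Re (cnj (v $ 0) * r * v $ 1))"
  unfolding quad_form_def sum_less_two herm2_index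
  by (simp add: complex_eq_iff cmod_power2) (simp add: power2_eq_square algebra_simps)

text \<open>With \<open>x\<close>, \<open>y\<close> the moduli of the coordinates, the form is at
  least the square of \<open>sqrt p * x - sqrt q * y\<close>.\<close>

lemma psd_herm2:
  assumes "0 \<le> p" "0 \<le> q" "(cmod r)\<^sup>2 \<le> p * q"
  shows "psd 2 (herm2 p q r)"
  unfolding psd_def
proof (intro conjI ballI)
  show "herm2 p q r \<in> carrier_mat 2 2" by (rule herm2_index)
  fix v :: "complex vec" assume v: "v \<in> carrier_vec 2"
  show "Im (quad_form 2 (herm2 p q r) v) = 0" by (simp only: quad_form_herm2[OF v] Im_complex_of_real)
  define x y where "x = cmod (v $ 0)" and "y = cmod (v $ 1)"
  have "cmod r \<le> sqrt p * sqrt q"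
    using assms real_le_rsqrt by (simp add: real_sqrt_mult[symmetric])
  then have "x * cmod r * y \<le> x * (sqrt p * sqrt q) * y"
    by (intro mult_right_mono mult_left_mono) (auto simp: x_def y_def)
  moreover have "\<bar>Re (cnj (v $ 0) * r * v $ 1)\<bar> \<le> x * cmod r * y"
    using abs_Re_le_cmod[of "cnj (v $ 0) * r * v $ 1"] by (simp add: x_def y_def norm_mult)
  moreover have "0 \<le> (sqrt p * x - sqrt q * y)\<^sup>2" by simp
  then have "2 * (x * (sqrt p * sqrt q) * y) \<le> p * x\<^sup>2 + q * y\<^sup>2"
    using assms by (simp add: power2_diff power_mult_distrib algebra_simps)
  ultimately show "0 \<le> Re (quad_form 2 (herm2 p q r) v)"
    unfolding quad_form_herm2[OF v] Re_complex_of_real x_def[symmetric] y_def[symmetric] by linarith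
qed

text \<open>The discriminant step of Schwarz-type inequalities, with \<open>g\<close> a squared
  modulus. The vertex \<open>s = 1 / a\<close> gives the bound; for \<open>a = 0\<close> the
  expression is affine in \<open>s\<close>, which forces \<open>g = 0\<close>.\<close>

lemma nonneg_quadratic_le:
  fixes g a c :: real
  assumes "0 \<le> g" "0 \<le> a" and quad: "\<And>s. 0 \<le> s\<^sup>2 * g * a - 2 * s * g + c"
  shows "g \<le> a * c"
proof (cases "a = 0")
  case True
  have "g = 0"
  proof (rule ccontr)
    assume "g \<noteq> 0"
    \<comment> \<open>At this \<open>s\<close> the expression equals -1.\<close>
    then show False using quad[of "(c + 1) / (2 * g)"] True by simp
  qed
  then show ?thesis using True by simp
next
  case False
  then have a: "0 < a" using assms by simp
  have "(1 / a)\<^sup>2 * g * a = g / a" using a by (simp add: power2_eq_square)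
  then have "g / a \<le> c" using quad[of "1 / a"] by simp
  then show ?thesis using a by (simp add: divide_le_eq mult.commute)
qed

lemma psd_two_herm2:
  assumes "psd 2 B"
  obtains p q r where "B = herm2 p q r" "0 \<le> p" "0 \<le> q" "(cmod r)\<^sup>2 \<le> p * q"
proof -
  have c: "B \<in> carrier_mat 2 2" using assms by (simp add: psd_def)
  define F where "F \<alpha> \<beta> = cnj \<alpha> * B $$ (0, 0) * \<alpha> + cnj \<alpha> * B $$ (0, 1) * \<beta>
    + (cnj \<beta> * B $$ (1, 0) * \<alpha> + cnj \<beta> * B $$ (1, 1) * \<beta>)" for \<alpha> \<beta>
  have F: "Im (F \<alpha> \<beta>) = 0" "0 \<le> Re (F \<alpha> \<beta>)" for \<alpha> \<beta>
  proof -
    let ?v = "vec 2 (\<lambda>i. if i = 0 then \<alpha> else \<beta>)"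
    have "quad_form 2 B ?v = F \<alpha> \<beta>" unfolding quad_form_def sum_less_two F_def by simp
    moreover have "?v \<in> carrier_vec 2" by simp
    ultimately show "Im (F \<alpha> \<beta>) = 0" "0 \<le> Re (F \<alpha> \<beta>)" using assms unfolding psd_def by metis+
  qed
  define p q r where "p = Re (B $$ (0, 0))" and "q = Re (B $$ (1, 1))" and "r = B $$ (0, 1)"
  have p: "0 \<le> p" "B $$ (0, 0) = complex_of_real p"
    using F[of 1 0] by (simp_all add: F_def p_def complex_eq_iff)
  have q: "0 \<le> q" "B $$ (1, 1) = complex_of_real q"
    using F[of 0 1] by (simp_all add: F_def q_def complex_eq_iff)
  \<comment> \<open>Polarisation: the imaginary parts at \<open>(1, 1)\<close> and
    \<open>(1, \<i>)\<close> determine the other off-diagonal entry.\<close>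
  have r: "B $$ (1, 0) = cnj r"
    using F[of 1 1] F[of 1 \<i>] p q by (simp add: F_def r_def complex_eq_iff)
  have B: "B = herm2 p q r"
    by (rule mat_two_eqI) (simp_all only: herm2_index c p q r r_def)
  have quad: "0 \<le> s\<^sup>2 * (cmod r)\<^sup>2 * p - 2 * s * (cmod r)\<^sup>2 + q" for s :: real
  proof -
    have "F (- s * r) 1 = complex_of_real (s\<^sup>2 * (cmod r)\<^sup>2 * p - 2 * s * (cmod r)\<^sup>2 + q)"
      unfolding F_def p q r r_def[symmetric] by (simp add: complex_eq_iff cmod_power2) (simp add: power2_eq_square algebra_simps)
    then show ?thesis using F(2)[of "- s * r" 1] by (metis Re_complex_of_real)
  qed
  have "(cmod r)\<^sup>2 \<le> p * q" by (rule nonneg_quadratic_le[OF _ p(1) quad]) simp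
  then show ?thesis using that B p q by blast
qed

text \<open>By Cayley-Hamilton a root \<open>B\<close> of \<open>A\<close> satisfies
  \<open>tr B * B = A + det B\<close>. Here \<delta> is the root of \<open>det A\<close>, hence
  \<open>det B\<close>, and \<open>t\<close> is \<open>tr B\<close>, because its square is
  \<open>tr A + 2 * det B\<close>. Positivity of \<open>a + b\<close> permits division by
  \<open>t\<close>.\<close>

lemma mat_sqrt_herm2:
  assumes "0 \<le> a" "0 \<le> b" "(cmod z)\<^sup>2 \<le> a * b" "0 < a + b"
  defines "\<delta> \<equiv> sqrt (a * b - (cmod z)\<^sup>2)"
  defines "t \<equiv> sqrt (a + b + 2 * \<delta>)"
  shows "mat_sqrt 2 (herm2 a b z) = herm2 ((a + \<delta>) / t) ((b + \<delta>) / t) (z / t)"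
proof -
  have \<delta>: "0 \<le> \<delta>" "\<delta>\<^sup>2 = a * b - (cmod z)\<^sup>2" using assms(3) by (simp_all add: \<delta>_def)
  have "0 < a + b + 2 * \<delta>" using assms(4) \<delta>(1) by linarith
  then have t: "0 < t" "t\<^sup>2 = a + b + 2 * \<delta>" by (simp_all add: t_def)
  have z: "(cmod (z / t))\<^sup>2 = (cmod z)\<^sup>2 / t\<^sup>2" using t by (simp add: norm_divide power_divide)
  have zz: "(cmod z)\<^sup>2 = a * b - \<delta>\<^sup>2" using \<delta> by simp
  show ?thesis unfolding mat_sqrt_def
  proof (rule the_equality, intro conjI)
    show "psd 2 (herm2 ((a + \<delta>) / t) ((b + \<delta>) / t) (z / t))"
    proof (rule psd_herm2)
      have "a * b \<le> (a + \<delta>) * (b + \<delta>)"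
        using assms(1,2) \<delta>(1) by (intro mult_mono) auto
      then have "(cmod z)\<^sup>2 \<le> (a + \<delta>) * (b + \<delta>)" using assms(3) by linarith
      then show "(cmod (z / t))\<^sup>2 \<le> (a + \<delta>) / t * ((b + \<delta>) / t)"
        unfolding z times_divide_times_eq power2_eq_square[of t] using t by (intro divide_right_mono) auto
    qed (use assms(1,2) \<delta> t in auto)
    have "((x + \<delta>) / t)\<^sup>2 + (cmod (z / t))\<^sup>2 = x"
      if "(x + \<delta>)\<^sup>2 + (a * b - \<delta>\<^sup>2) = x * (a + b + 2 * \<delta>)" for x
    proof -
      have "((x + \<delta>) / t)\<^sup>2 + (cmod (z / t))\<^sup>2 = x * t\<^sup>2 / t\<^sup>2"
        unfolding z zz power_divide add_divide_distrib[symmetric] that t(2) ..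
      then show ?thesis using t(1) by simp
    qed
    from this[of a] this[of b]
    have ab: "((a + \<delta>) / t)\<^sup>2 + (cmod (z / t))\<^sup>2 = a" "((b + \<delta>) / t)\<^sup>2 + (cmod (z / t))\<^sup>2 = b"
      by (simp_all add: power2_eq_square algebra_simps)
    have "(a + \<delta>) / t + (b + \<delta>) / t = t\<^sup>2 / t"
      unfolding t(2) by (simp add: add_divide_distrib)
    then have tt: "(a + \<delta>) / t + (b + \<delta>) / t = t" using t(1) by (simp add: power2_eq_square)
    have "z / t * (complex_of_real ((a + \<delta>) / t) + complex_of_real ((b + \<delta>) / t)) = z"
      unfolding of_real_add[symmetric] tt using t(1) by simp
    then show "herm2 ((a + \<delta>) / t) ((b + \<delta>) / t) (z / t) * herm2 ((a + \<delta>) / t) ((b + \<delta>) / t) (z / t) = herm2 a b z"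
      unfolding herm2_square ab by simp
  next
    fix B assume "psd 2 B \<and> B * B = herm2 a b z"
    then obtain p q r where B: "B = herm2 p q r" and nn: "0 \<le> p" "0 \<le> q" "(cmod r)\<^sup>2 \<le> p * q"
      and sq: "herm2 (p\<^sup>2 + (cmod r)\<^sup>2) (q\<^sup>2 + (cmod r)\<^sup>2) (r * (p + q)) = herm2 a b z"
      using psd_two_herm2 herm2_square by metis
    have a: "a = p\<^sup>2 + (cmod r)\<^sup>2" using arg_cong[OF sq, of "\<lambda>A. A $$ (0, 0)"] by (simp only: herm2_index of_real_eq_iff)
    have b: "b = q\<^sup>2 + (cmod r)\<^sup>2" using arg_cong[OF sq, of "\<lambda>A. A $$ (1, 1)"] by (simp only: herm2_index of_real_eq_iff)
    have z': "z = r * complex_of_real (p + q)" using arg_cong[OF sq, of "\<lambda>A. A $$ (0, 1)"] by (simp only: herm2_index of_real_add)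
    have cz: "(cmod z)\<^sup>2 = (cmod r)\<^sup>2 * (p + q)\<^sup>2"
      unfolding z' norm_mult norm_of_real power_mult_distrib power2_abs ..
    \<comment> \<open>Multiplicativity of the determinant; positivity of \<open>B\<close> selects
      the nonnegative root.\<close>
    have "a * b - (cmod z)\<^sup>2 = (p * q - (cmod r)\<^sup>2)\<^sup>2"
      unfolding a b cz by (simp add: power2_eq_square algebra_simps)
    then have d: "\<delta> = p * q - (cmod r)\<^sup>2" using nn unfolding \<delta>_def by simp
    have "a + b + 2 * \<delta> = (p + q)\<^sup>2" unfolding a b d by (simp add: power2_eq_square algebra_simps)
    then have t': "t = p + q" using nn unfolding t_def by simp
    have "a + \<delta> = p * t" "b + \<delta> = q * t" unfolding a b d t' by (simp_all add: power2_eq_square algebra_simps)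
    then show "B = herm2 ((a + \<delta>) / t) ((b + \<delta>) / t) (z / t)"
      using t z' unfolding B t'[symmetric] by simp
  qed
qed

lemma mtrace_mat_sqrt_herm2:
  assumes "0 \<le> a" "0 \<le> b" "(cmod z)\<^sup>2 \<le> a * b" "0 < a + b"
  shows "(Re (mtrace (mat_sqrt 2 (herm2 a b z))))\<^sup>2 = a + b + 2 * sqrt (a * b - (cmod z)\<^sup>2)"
proof -
  define \<delta> where "\<delta> = sqrt (a * b - (cmod z)\<^sup>2)"
  define t where "t = sqrt (a + b + 2 * \<delta>)"
  have t: "0 < t" "t\<^sup>2 = a + b + 2 * \<delta>" using assms by (simp_all add: \<delta>_def t_def add_pos_nonneg)
  have "Re (mtrace (mat_sqrt 2 (herm2 a b z))) = (a + \<delta>) / t + (b + \<delta>) / t"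
    unfolding mat_sqrt_herm2[OF assms] mtrace_def \<delta>_def[symmetric] t_def[symmetric]
    using herm2_index(1) by (simp add: herm2_def sum_less_two)
  also have "\<dots> = t\<^sup>2 / t" unfolding t(2) by (simp add: add_divide_distrib)
  also have "\<dots> = t" using t(1) by (simp add: power2_eq_square)
  finally show ?thesis using t by (simp add: \<delta>_def)
qed

section \<open>Concurrence as a Gram determinant\<close>

lemma lagrange_identity:
  fixes x y :: "nat \<Rightarrow> complex"
  shows "(\<Sum>i<d. \<Sum>j<d. (cmod (x i * y j - x j * y i))\<^sup>2)
    = 2 * (sqnorm {..<d} x * sqnorm {..<d} y - (cmod (\<Sum>i<d. x i * cnj (y i)))\<^sup>2)"
proof -
  have "complex_of_real (\<Sum>i<d. \<Sum>j<d. (cmod (x i * y j - x j * y i))\<^sup>2)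
      = (\<Sum>i<d. \<Sum>j<d. (x i * cnj (x i)) * (y j * cnj (y j))) + (\<Sum>i<d. \<Sum>j<d. (y i * cnj (y i)) * (x j * cnj (x j)))
        - (\<Sum>i<d. \<Sum>j<d. (x i * cnj (y i)) * (cnj (x j) * y j)) - (\<Sum>i<d. \<Sum>j<d. (cnj (x i) * y i) * (x j * cnj (y j)))"
    unfolding of_real_sum complex_norm_square sum.distrib[symmetric] sum_subtractf[symmetric]
    by (intro sum.cong refl) (simp add: algebra_simps)
  also have "\<dots> = 2 * ((\<Sum>i<d. x i * cnj (x i)) * (\<Sum>i<d. y i * cnj (y i))
       - (\<Sum>i<d. x i * cnj (y i)) * cnj (\<Sum>i<d. x i * cnj (y i)))"
    unfolding sum_product[symmetric] by (simp add: algebra_simps)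
  also have "\<dots> = complex_of_real (2 * (sqnorm {..<d} x * sqnorm {..<d} y - (cmod (\<Sum>i<d. x i * cnj (y i)))\<^sup>2))"
    by (simp only: of_real_mult of_real_diff of_real_sqnorm complex_norm_square of_real_numeral)
  finally show ?thesis by (simp only: of_real_eq_iff)
qed

text \<open>By the Lagrange identity. The expression under the root is the determinant of the
  reduced matrix of the qubit, which links \<open>conc\<close> to
  \<open>mtrace_mat_sqrt_herm2\<close>.\<close>

lemma conc_gram:
  "conc d f = 2 * sqrt (sqnorm {..<d} f * sqnorm {..<d} (\<lambda>i. f (d + i)) - (cmod (\<Sum>i<d. f i * cnj (f (d + i))))\<^sup>2)"
  (is "_ = 2 * sqrt ?g")
proof -
  have "conc d f = sqrt (4 * ?g)" unfolding conc_def lagrange_identity by simp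
  then show ?thesis by (simp only: real_sqrt_mult real_sqrt_four)
qed

lemma gram_le: "(cmod (\<Sum>i<d. x i * cnj (y i)))\<^sup>2 \<le> sqnorm {..<d} x * sqnorm {..<(d::nat)} y"
proof -
  have "0 \<le> (\<Sum>i<d. \<Sum>j<d. (cmod (x i * y j - x j * y i))\<^sup>2)" by (intro sum_nonneg) auto
  then show ?thesis unfolding lagrange_identity by simp
qed

text \<open>The arithmetic-geometric mean inequality for the squared norms of the two halves of
  \<open>f\<close>. It later bounds all ensemble averages by the trace.\<close>

lemma conc_le_sqnorm: "conc d f \<le> sqnorm {..<2 * d} f"
proof -
  define a b where "a = sqnorm {..<d} f" and "b = sqnorm {..<d} (\<lambda>i. f (d + i))"
  have nn: "0 \<le> a" "0 \<le> b" by (auto simp: a_def b_def intro!: sum_nonneg)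
  have "0 \<le> (a - b)\<^sup>2" by simp
  then have "4 * (a * b) \<le> (a + b)\<^sup>2" by (simp add: power2_eq_square algebra_simps)
  then have "sqrt (4 * (a * b)) \<le> a + b" using nn by (simp add: real_le_lsqrt)
  moreover have "conc d f \<le> 2 * sqrt (a * b)"
    unfolding conc_gram a_def b_def by simp
  ultimately show ?thesis by (simp add: real_sqrt_mult sum_lessThan_double a_def b_def)
qed

text \<open>The reduced matrix of the qubit has trace 1, so the squared trace of its root is 1 plus
  twice the root of its determinant.\<close>

lemma negativity_pure_eq_conc:
  assumes "unit_vec (2 * d) \<psi>"
  shows "negativity_pure 2 d \<psi> = conc d (\<lambda>i. \<psi> $ i)"
proof -
  define f where "f i = \<psi> $ i" for i
  define a b z where "a = sqnorm {..<d} f" and "b = sqnorm {..<d} (\<lambda>i. f (d + i))"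
    and "z = (\<Sum>i<d. f i * cnj (f (d + i)))"
  have dim: "dim_vec \<psi> = 2 * d" and ab: "a + b = 1"
    using assms by (simp_all add: unit_vec_def sum_lessThan_double a_def b_def f_def)
  have nn: "0 \<le> a" "0 \<le> b" by (auto simp: a_def b_def intro!: sum_nonneg)
  have le: "(cmod z)\<^sup>2 \<le> a * b" unfolding a_def b_def z_def by (rule gram_le)
  have e: "ptrace_2 2 d (proj \<psi>) $$ (i, j) = (\<Sum>k<d. f (i * d + k) * cnj (f (j * d + k)))" if "i < 2" "j < 2" for i j
  proof -
    have "l * d + k < 2 * d" if "l < 2" "k < d" for l k using that by (auto simp: less_2_cases_iff)
    then show ?thesis using that dim by (auto simp: ptrace_2_def proj_def f_def intro!: sum.cong)
  qed
  have "ptrace_2 2 d (proj \<psi>) = herm2 a b z"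
  proof (rule mat_two_eqI)
    show "ptrace_2 2 d (proj \<psi>) \<in> carrier_mat 2 2" by (simp add: ptrace_2_def)
    show "ptrace_2 2 d (proj \<psi>) $$ (0, 0) = herm2 a b z $$ (0, 0)"
      unfolding herm2_index a_def of_real_sqnorm by (simp add: e)
    show "ptrace_2 2 d (proj \<psi>) $$ (1, 1) = herm2 a b z $$ (1, 1)"
      unfolding herm2_index b_def of_real_sqnorm by (subst e) simp_all
    show "ptrace_2 2 d (proj \<psi>) $$ (0, 1) = herm2 a b z $$ (0, 1)"
      unfolding herm2_index z_def by (subst e) simp_all
    show "ptrace_2 2 d (proj \<psi>) $$ (1, 0) = herm2 a b z $$ (1, 0)"
      unfolding herm2_index z_def by (subst e) (simp_all add: mult.commute)
  qed (rule herm2_index)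
  then have "negativity_pure 2 d \<psi> = 2 * sqrt (a * b - (cmod z)\<^sup>2)"
    unfolding negativity_pure_def using mtrace_mat_sqrt_herm2[OF nn le] ab by simp
  then show ?thesis unfolding conc_gram a_def b_def z_def f_def .
qed

section \<open>Ensembles as decompositions into outer products\<close>

text \<open>An unnormalised form of \<open>pure_ensemble\<close>: each vector carries the square
  root of its probability. Zero vectors are allowed, and index sets may be products, which suits
  repeated measurements.\<close>

definition decomposes :: "nat \<Rightarrow> complex mat \<Rightarrow> 'k set \<Rightarrow> ('k \<Rightarrow> nat \<Rightarrow> complex) \<Rightarrow> bool" where
  "decomposes D M K \<phi> \<longleftrightarrow> (\<forall>i<D. \<forall>j<D. M $$ (i, j) = (\<Sum>k\<in>K. \<phi> k i * cnj (\<phi> k j)))"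

lemma conc_nonneg: "0 \<le> conc d f"
  unfolding conc_def by (intro real_sqrt_ge_zero mult_nonneg_nonneg sum_nonneg) auto

lemma conc_cong:
  assumes "\<And>i. i < 2 * d \<Longrightarrow> f i = g i"
  shows "conc d f = conc d g"
  using assms unfolding conc_def by (auto intro!: arg_cong[of _ _ sqrt] sum.cong)

lemma conc_scale: "conc d (\<lambda>i. a * f i) = (cmod a)\<^sup>2 * conc d f"
proof -
  have "a * f i * (a * f (d + j)) - a * f j * (a * f (d + i)) = a\<^sup>2 * (f i * f (d + j) - f j * f (d + i))" for i j
    by (simp add: power2_eq_square algebra_simps)
  then have "(cmod (a * f i * (a * f (d + j)) - a * f j * (a * f (d + i))))\<^sup>2
      = ((cmod a)\<^sup>2)\<^sup>2 * (cmod (f i * f (d + j) - f j * f (d + i)))\<^sup>2" for i j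
    by (simp only: norm_mult norm_power power_mult_distrib)
  then have "conc d (\<lambda>i. a * f i)
      = sqrt (2 * (((cmod a)\<^sup>2)\<^sup>2 * (\<Sum>i<d. \<Sum>j<d. (cmod (f i * f (d + j) - f j * f (d + i)))\<^sup>2)))"
    by (simp only: conc_def sum_distrib_left)
  then show ?thesis by (simp only: conc_def real_sqrt_mult real_sqrt_abs) simp
qed

lemma sum_list_pair_nth: "(\<Sum>(p, \<psi>)\<leftarrow>E. g p \<psi>) = (\<Sum>k<length E. g (fst (E ! k)) (snd (E ! k)))"
  by (simp add: sum_list_sum_nth atLeast0LessThan case_prod_unfold)

lemma pure_ensemble_decomposes:
  assumes "pure_ensemble (2 * d) M E"
  obtains \<phi> where "decomposes (2 * d) M {..<length E} \<phi>"
    "(\<Sum>(p, \<psi>)\<leftarrow>E. p * negativity_pure 2 d \<psi>) = (\<Sum>k<length E. conc d (\<phi> k))"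
proof -
  define p where "p k = fst (E ! k)" for k
  define \<psi> where "\<psi> k = snd (E ! k)" for k
  have k: "0 \<le> p k" "unit_vec (2 * d) (\<psi> k)" if "k < length E" for k
    using assms nth_mem[OF that] unfolding pure_ensemble_def p_def \<psi>_def by (auto simp: case_prod_unfold)
  have M: "M = mat (2 * d) (2 * d) (\<lambda>(i, j). \<Sum>k<length E. complex_of_real (p k) * \<psi> k $ i * cnj (\<psi> k $ j))"
    using assms unfolding pure_ensemble_def sum_list_pair_nth p_def \<psi>_def by blast
  show ?thesis
  proof (rule that[of "\<lambda>k i. complex_of_real (sqrt (p k)) * \<psi> k $ i"])
    have s: "complex_of_real (sqrt (p k)) * complex_of_real (sqrt (p k)) = complex_of_real (p k)" if "k < length E" for k
      using k[OF that] by (simp flip: of_real_mult)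
    have outer: "complex_of_real (p k) * \<psi> k $ i * cnj (\<psi> k $ j) = complex_of_real (sqrt (p k)) * \<psi> k $ i *
      cnj (complex_of_real (sqrt (p k)) * \<psi> k $ j)" if "k < length E" for k i j
      unfolding s[OF that, symmetric] by simp
    show "decomposes (2 * d) M {..<length E} (\<lambda>k i. complex_of_real (sqrt (p k)) * \<psi> k $ i)"
      unfolding decomposes_def
    proof (intro allI impI)
      fix i j assume ij: "i < 2 * d" "j < 2 * d"
      show "M $$ (i, j) = (\<Sum>k<length E. complex_of_real (sqrt (p k)) * \<psi> k $ i *
          cnj (complex_of_real (sqrt (p k)) * \<psi> k $ j))"
        unfolding M index_mat(1)[OF ij] prod.case by (rule sum.cong[OF refl], rule outer) simp
    qed
    show "(\<Sum>(p, \<psi>)\<leftarrow>E. p * negativity_pure 2 d \<psi>)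
        = (\<Sum>k<length E. conc d (\<lambda>i. complex_of_real (sqrt (p k)) * \<psi> k $ i))"
      unfolding sum_list_pair_nth p_def[symmetric] \<psi>_def[symmetric] conc_scale
      by (intro sum.cong refl) (simp add: k negativity_pure_eq_conc)
  qed
qed

lemma decomposes_sum_conc_le:
  assumes "decomposes (2 * d) M K \<phi>"
  shows "(\<Sum>k\<in>K. conc d (\<phi> k)) \<le> Re (\<Sum>i<2 * d. M $$ (i, i))"
proof -
  have "(\<Sum>k\<in>K. conc d (\<phi> k)) \<le> (\<Sum>k\<in>K. sqnorm {..<2 * d} (\<phi> k))"
    by (intro sum_mono conc_le_sqnorm)
  also have "\<dots> = (\<Sum>i<2 * d. sqnorm K (\<lambda>k. \<phi> k i))" by (rule sum.swap)
  also have "\<dots> = Re (\<Sum>i<2 * d. complex_of_real (sqnorm K (\<lambda>k. \<phi> k i)))" by simp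
  also have "(\<Sum>i<2 * d. complex_of_real (sqnorm K (\<lambda>k. \<phi> k i))) = (\<Sum>i<2 * d. M $$ (i, i))"
    using assms unfolding decomposes_def of_real_sqnorm by simp
  finally show ?thesis .
qed

text \<open>The squared norms become the probabilities. Zero vectors cannot be normalised and are
  dropped; they contribute neither to \<open>M\<close> nor to the sum of concurrences.\<close>

lemma decomposes_pure_ensemble:
  assumes "finite K" "M \<in> carrier_mat (2 * d) (2 * d)" "decomposes (2 * d) M K \<phi>"
  obtains E where "pure_ensemble (2 * d) M E"
    "(\<Sum>(p, \<psi>)\<leftarrow>E. p * negativity_pure 2 d \<psi>) = (\<Sum>k\<in>K. conc d (\<phi> k))"
proof -
  define N where "N k = sqnorm {..<2 * d} (\<phi> k)" for k
  define J where "J = {k \<in> K. N k \<noteq> 0}"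
  have Jpos: "0 < N k" if "k \<in> J" for k
    using that unfolding J_def N_def by (simp add: less_le sum_nonneg)
  have zero: "\<phi> k i = 0" if "k \<in> K - J" "i < 2 * d" for k i
    using that unfolding J_def N_def by (auto simp: sum_nonneg_eq_0_iff)
  obtain xs where xs: "set xs = J" "distinct xs"
    using assms(1) finite_distinct_list[of J] unfolding J_def by auto
  define \<psi> where "\<psi> k = vec (2 * d) (\<lambda>i. \<phi> k i / complex_of_real (sqrt (N k)))" for k
  define E where "E = map (\<lambda>k. (N k, \<psi> k)) xs"
  have sumE: "(\<Sum>(p, \<psi>)\<leftarrow>E. g p \<psi>) = (\<Sum>k\<in>J. g (N k) (\<psi> k))" for g :: "real \<Rightarrow> complex vec \<Rightarrow> 'z :: comm_monoid_add"
    using xs by (simp add: E_def o_def sum_list_distinct_conv_sum_set)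
  have unit: "unit_vec (2 * d) (\<psi> k)" if "k \<in> J" for k
  proof -
    have "(\<Sum>i<2 * d. (cmod (\<psi> k $ i))\<^sup>2) = (\<Sum>i<2 * d. (cmod (\<phi> k i))\<^sup>2 / N k)"
      using Jpos[OF that] by (intro sum.cong refl) (auto simp: \<psi>_def norm_divide power_divide)
    also have "\<dots> = 1" using Jpos[OF that] by (simp add: N_def flip: sum_divide_distrib)
    finally show ?thesis by (simp add: unit_vec_def \<psi>_def)
  qed
  have sq: "complex_of_real (sqrt (N k)) * complex_of_real (sqrt (N k)) = complex_of_real (N k)" if "k \<in> J" for k
    using Jpos[OF that] by (simp flip: of_real_mult)
  have \<phi>: "\<phi> k i = complex_of_real (sqrt (N k)) * \<psi> k $ i" if "k \<in> J" "i < 2 * d" for k i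
    using Jpos[OF that(1)] that(2) by (simp add: \<psi>_def)
  have outer: "complex_of_real (N k) * \<psi> k $ i * cnj (\<psi> k $ j) = \<phi> k i * cnj (\<phi> k j)"
    if "k \<in> J" "i < 2 * d" "j < 2 * d" for k i j
    unfolding \<phi>[OF that(1,2)] \<phi>[OF that(1,3)] sq[OF that(1), symmetric] by simp
  show ?thesis
  proof (rule that[of E])
    have "M = mat (2 * d) (2 * d) (\<lambda>(i, j). \<Sum>k\<in>J. complex_of_real (N k) * \<psi> k $ i * cnj (\<psi> k $ j))"
    proof (rule eq_matI)
      fix i j assume "i < dim_row (mat (2 * d) (2 * d) (\<lambda>(i, j). \<Sum>k\<in>J. complex_of_real (N k) * \<psi> k $ i * cnj (\<psi> k $ j)))"
        "j < dim_col (mat (2 * d) (2 * d) (\<lambda>(i, j). \<Sum>k\<in>J. complex_of_real (N k) * \<psi> k $ i * cnj (\<psi> k $ j)))"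
      then have ij: "i < 2 * d" "j < 2 * d" by simp_all
      have "(\<Sum>k\<in>K. \<phi> k i * cnj (\<phi> k j)) = (\<Sum>k\<in>J. \<phi> k i * cnj (\<phi> k j))"
        using assms(1) zero ij by (intro sum.mono_neutral_right) (auto simp: J_def)
      then show "M $$ (i, j) = mat (2 * d) (2 * d) (\<lambda>(i, j). \<Sum>k\<in>J. complex_of_real (N k) * \<psi> k $ i * cnj (\<psi> k $ j)) $$ (i, j)"
        using assms(3) ij by (simp add: decomposes_def outer)
    qed (use assms(2) in auto)
    then show "pure_ensemble (2 * d) M E"
      unfolding pure_ensemble_def sumE using xs Jpos unit by (auto simp: E_def less_imp_le)
    have val: "N k * negativity_pure 2 d (\<psi> k) = conc d (\<phi> k)" if "k \<in> J" for k
    proof -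
      have "conc d (\<phi> k) = conc d (\<lambda>i. complex_of_real (sqrt (N k)) * \<psi> k $ i)"
        by (rule conc_cong) (rule \<phi>[OF that])
      then show ?thesis
        using negativity_pure_eq_conc[OF unit[OF that]] Jpos[OF that] by (simp add: conc_scale)
    qed
    have conc0: "conc d (\<phi> k) = 0" if "k \<in> K - J" for k
    proof -
      have "conc d (\<phi> k) = conc d (\<lambda>_. 0)" by (rule conc_cong) (rule zero[OF that])
      then show ?thesis by (simp add: conc_def)
    qed
    have "(\<Sum>k\<in>K. conc d (\<phi> k)) = (\<Sum>k\<in>J. conc d (\<phi> k))"
      using conc0 assms(1) by (intro sum.mono_neutral_right) (auto simp: J_def)
    then show "(\<Sum>(p, \<psi>)\<leftarrow>E. p * negativity_pure 2 d \<psi>) = (\<Sum>k\<in>K. conc d (\<phi> k))"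
      unfolding sumE by (simp only: val cong: sum.cong)
  qed
qed

text \<open>A real \<open>Sup\<close> dominates the elements of its set only if the set is bounded
  above; the trace of \<open>M\<close> provides the bound.\<close>

lemma negativity_assist_ge:
  assumes "finite K" "M \<in> carrier_mat (2 * d) (2 * d)" "decomposes (2 * d) M K \<phi>"
  shows "(\<Sum>k\<in>K. conc d (\<phi> k)) \<le> negativity_assist 2 d M"
proof -
  let ?S = "{(\<Sum>(p, \<psi>)\<leftarrow>E. p * negativity_pure 2 d \<psi>) |E. pure_ensemble (2 * d) M E}"
  have "x \<le> Re (\<Sum>i<2 * d. M $$ (i, i))" if S: "x \<in> ?S" for x
  proof -
    obtain E where "pure_ensemble (2 * d) M E" and x: "x = (\<Sum>(p, \<psi>)\<leftarrow>E. p * negativity_pure 2 d \<psi>)"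
      using S by blast
    from this(1) show ?thesis unfolding x by (rule pure_ensemble_decomposes) (simp only: decomposes_sum_conc_le)
  qed
  then have "bdd_above ?S" by (rule bdd_aboveI)
  moreover obtain E where "pure_ensemble (2 * d) M E"
    "(\<Sum>(p, \<psi>)\<leftarrow>E. p * negativity_pure 2 d \<psi>) = (\<Sum>k\<in>K. conc d (\<phi> k))"
    by (rule decomposes_pure_ensemble[OF assms])
  then have "(\<Sum>k\<in>K. conc d (\<phi> k)) \<in> ?S" unfolding mem_Collect_eq by metis
  ultimately show ?thesis unfolding negativity_assist_def by (intro cSup_upper)
qed

text \<open>The decomposition over \<open>K\<close> witnesses that the set of averages is nonempty,
  as \<open>cSup_least\<close> demands.\<close>

lemma negativity_assist_le:
  assumes "finite K" "M \<in> carrier_mat (2 * d) (2 * d)" "decomposes (2 * d) M K \<phi>"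
    and "\<And>(n::nat) \<phi>. decomposes (2 * d) M {..<n} \<phi> \<Longrightarrow> (\<Sum>k<n. conc d (\<phi> k)) \<le> c"
  shows "negativity_assist 2 d M \<le> c"
  unfolding negativity_assist_def
proof (rule cSup_least)
  show "{(\<Sum>(p, \<psi>)\<leftarrow>E. p * negativity_pure 2 d \<psi>) |E. pure_ensemble (2 * d) M E} \<noteq> {}"
    using decomposes_pure_ensemble[OF assms(1-3)] by blast
  fix x assume "x \<in> {(\<Sum>(p, \<psi>)\<leftarrow>E. p * negativity_pure 2 d \<psi>) |E. pure_ensemble (2 * d) M E}"
  then obtain E where "pure_ensemble (2 * d) M E" and x: "x = (\<Sum>(p, \<psi>)\<leftarrow>E. p * negativity_pure 2 d \<psi>)"
    by blast
  from this(1) show "x \<le> c" unfolding x by (rule pure_ensemble_decomposes) (simp only: assms(4))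
qed

section \<open>Positive semidefinite matrices as sums of outer products\<close>

abbreviation qf :: "nat \<Rightarrow> (nat \<Rightarrow> nat \<Rightarrow> complex) \<Rightarrow> (nat \<Rightarrow> complex) \<Rightarrow> complex" where
  "qf D A x \<equiv> (\<Sum>i<D. \<Sum>j<D. cnj (x i) * A i j * x j)"

definition nonneg_form :: "nat \<Rightarrow> (nat \<Rightarrow> nat \<Rightarrow> complex) \<Rightarrow> bool" where
  "nonneg_form D A \<longleftrightarrow> (\<forall>x. Im (qf D A x) = 0 \<and> 0 \<le> Re (qf D A x))"

lemma nonneg_formD:
  assumes "nonneg_form D A"
  shows "Im (qf D A x) = 0" "0 \<le> Re (qf D A x)"
  using assms spec[of _ x] unfolding nonneg_form_def by (simp_all only:)

lemma qf_add_unit: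
  assumes "k < D"
  shows "qf D A (\<lambda>i. x i + t * (if i = k then 1 else 0))
    = qf D A x + cnj t * (\<Sum>j<D. A k j * x j) + t * (\<Sum>i<D. cnj (x i) * A i k) + cnj t * t * A k k"
proof -
  define e where "e i = (if i = k then 1 else 0 :: complex)" for i
  have e: "(\<Sum>i<D. e i * g i) = g k" for g using assms by (simp add: e_def if_one_times)
  have ce: "cnj (e i) = e i" for i by (simp add: e_def)
  have "qf D A (\<lambda>i. x i + t * e i) = qf D A x + cnj t * (\<Sum>i<D. e i * (\<Sum>j<D. A i j * x j))
      + t * (\<Sum>i<D. cnj (x i) * (\<Sum>j<D. e j * A i j)) + cnj t * t * (\<Sum>i<D. e i * (\<Sum>j<D. e j * A i j))"
    unfolding sum_distrib_left sum.distrib[symmetric]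
    by (intro sum.cong refl) (simp add: ce algebra_simps)
  then show ?thesis unfolding e unfolding e_def .
qed

text \<open>Polarisation: the form is real at the unit vector of \<open>l\<close> plus
  \<open>t\<close> times that of \<open>k\<close>, for \<open>t = 1\<close> and
  \<open>t = \<i>\<close>.\<close>

lemma nonneg_form_hermitian:
  assumes A: "nonneg_form D A" and kl: "k < D" "l < D"
  shows "A l k = cnj (A k l)"
proof -
  have unit: "(\<Sum>j<D. B j * (if j = l then 1 else 0)) = B l" "(\<Sum>j<D. cnj (if j = l then 1 else 0) * B j) = B l"
    if "l < D" for B l
  proof -
    have "cnj (if j = l then 1 else 0) * B j = (if j = l then B j else 0)" for j by simp
    then show "(\<Sum>j<D. B j * (if j = l then 1 else 0)) = B l" "(\<Sum>j<D. cnj (if j = l then 1 else 0) * B j) = B l"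
      using that by (simp_all only: times_if_one) simp_all
  qed
  have diag: "Im (A k k) = 0" if "k < D" for k
  proof -
    have "Im (qf D A (\<lambda>i. 0 + 1 * (if i = k then 1 else 0))) = 0" by (rule nonneg_formD[OF A])
    then show ?thesis unfolding qf_add_unit[OF that] by simp
  qed
  have im: "Im (cnj t * A k l + t * A l k) = 0" for t
  proof -
    let ?x = "\<lambda>i. if i = l then 1 else 0 :: complex"
    have "Im (qf D A (\<lambda>i. ?x i + t * (if i = k then 1 else 0))) = 0" "Im (qf D A ?x) = 0"
      by (rule nonneg_formD[OF A])+
    moreover have "Im (cnj t * t * A k k) = 0" using diag[OF kl(1)] by simp
    ultimately show ?thesis
      unfolding qf_add_unit[OF kl(1)] unit[OF kl(2)] plus_complex.sel by linarith
  qed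
  show ?thesis using im[of 1] im[of \<i>] by (simp add: complex_eq_iff)
qed

text \<open>The Cauchy-Schwarz inequality of the form between \<open>x\<close> and a unit vector,
  from moving \<open>x\<close> by \<open>- s * g\<close> in coordinate \<open>k\<close>.\<close>

lemma nonneg_form_row_bound:
  assumes A: "nonneg_form D A" and k: "k < D"
  shows "0 \<le> Re (A k k)" "(cmod (\<Sum>j<D. A k j * x j))\<^sup>2 \<le> Re (A k k) * Re (qf D A x)"
proof -
  define a where "a = Re (A k k)"
  have "A k k = cnj (A k k)" by (rule nonneg_form_hermitian[OF A k k])
  then have Akk: "A k k = complex_of_real a" by (simp add: a_def complex_eq_iff)
  have "0 \<le> Re (qf D A (\<lambda>i. 0 + 1 * (if i = k then 1 else 0)))" by (rule nonneg_formD[OF A])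
  then show a: "0 \<le> Re (A k k)" unfolding qf_add_unit[OF k] by simp
  define g where "g = (\<Sum>j<D. A k j * x j)"
  have g': "(\<Sum>i<D. cnj (x i) * A i k) = cnj g"
    unfolding g_def cnj_sum by (intro sum.cong refl) (simp add: nonneg_form_hermitian[OF A k] mult.commute)
  show "(cmod (\<Sum>j<D. A k j * x j))\<^sup>2 \<le> Re (A k k) * Re (qf D A x)"
    unfolding g_def[symmetric]
  proof (rule nonneg_quadratic_le[OF _ a])
    fix s :: real
    let ?t = "- complex_of_real s * g"
    have "0 \<le> Re (qf D A (\<lambda>i. x i + ?t * (if i = k then 1 else 0)))"
      by (rule nonneg_formD[OF A])
    also have "qf D A (\<lambda>i. x i + ?t * (if i = k then 1 else 0))
        = qf D A x + cnj ?t * g + ?t * cnj g + cnj ?t * ?t * complex_of_real a"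
      unfolding qf_add_unit[OF k] g' g_def[symmetric] Akk ..
    also have "cnj ?t * g + ?t * cnj g + cnj ?t * ?t * complex_of_real a
        = complex_of_real (s\<^sup>2 * (cmod g)\<^sup>2 * a - 2 * s * (cmod g)\<^sup>2)" 
      unfolding of_real_diff of_real_mult complex_norm_square by (simp add: power2_eq_square algebra_simps)
    then have "qf D A x + cnj ?t * g + ?t * cnj g + cnj ?t * ?t * complex_of_real a
        = qf D A x + complex_of_real (s\<^sup>2 * (cmod g)\<^sup>2 * a - 2 * s * (cmod g)\<^sup>2)" by (simp only: add.assoc)
    finally show "0 \<le> s\<^sup>2 * (cmod g)\<^sup>2 * Re (A k k) - 2 * s * (cmod g)\<^sup>2 + Re (qf D A x)"
      by (simp add: Akk)
  qed simp
qed

text \<open>Cholesky factorisation; \<open>j\<close> counts the trailing rows and columns that are not yet eliminated.\<close>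

lemma nonneg_form_outer_products:
  assumes "nonneg_form D A" "j \<le> D"
    "\<And>i l. i < D \<Longrightarrow> l < D \<Longrightarrow> i < D - j \<or> l < D - j \<Longrightarrow> A i l = 0"
  shows "\<exists>\<phi>. \<forall>i<D. \<forall>l<D. A i l = (\<Sum>k<j. \<phi> k i * cnj (\<phi> k l))"
  using assms
proof (induction j arbitrary: A)
  case 0
  then show ?case by simp
next
  case (Suc j)
  define k where "k = D - Suc j"
  have k: "k < D" "D - j = Suc k" using Suc.prems(2) by (auto simp: k_def)
  have z: "A i l = 0" if "i < D" "l < D" "i < k \<or> l < k" for i l
    using Suc.prems(3) that unfolding k_def by blast
  define a where "a = Re (A k k)"
  note herm = nonneg_form_hermitian[OF Suc.prems(1)]
  have "A k k = cnj (A k k)" by (rule herm[OF k(1) k(1)])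
  then have Akk: "A k k = complex_of_real a" by (simp add: a_def complex_eq_iff)
  have a: "0 \<le> a" and row: "(cmod (\<Sum>j<D. A k j * x j))\<^sup>2 \<le> a * Re (qf D A x)" for x
    unfolding a_def by (rule nonneg_form_row_bound[OF Suc.prems(1) k(1)])+
  \<comment> \<open>If \<open>a = 0\<close>, then \<open>v = 0\<close> by the convention \<open>x / 0 = 0\<close>.\<close>
  define v where "v i = A i k / complex_of_real (sqrt a)" for i
  define A' where "A' i l = A i l - v i * cnj (v l)" for i l
  have aa: "complex_of_real (sqrt a) * complex_of_real (sqrt a) = complex_of_real a"
    using a by (simp flip: of_real_mult)
  \<comment> \<open>A zero pivot has a zero row by the Cauchy-Schwarz bound, so nothing remains to
    be eliminated there.\<close>
  have Ak: "A k l = 0" if "a = 0" "l < D" for l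
  proof -
    have "(\<Sum>j<D. A k j * (if j = l then 1 else 0)) = A k l" using that(2) by (simp add: times_if_one)
    then have "(cmod (A k l))\<^sup>2 \<le> 0" using row[of "\<lambda>j. if j = l then 1 else 0"] that(1) by simp
    then show ?thesis by simp
  qed
  have k0: "A' k l = 0" if "l < D" for l
  proof (cases "a = 0")
    case True
    then show ?thesis using Ak that by (simp add: A'_def v_def)
  next
    case False
    have "v k * cnj (v l) = complex_of_real a * A k l / (complex_of_real (sqrt a) * complex_of_real (sqrt a))"
      unfolding v_def Akk using herm[OF that k(1)] by simp
    then show ?thesis using False by (simp add: A'_def aa)
  qed
  have A'herm: "A' l i = cnj (A' i l)" if "i < D" "l < D" for i l
    using herm[OF that] by (simp add: A'_def)
  \<comment> \<open>\<open>A'\<close> is the Schur complement: its form is that of \<open>A\<close>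
    minus \<open>(cmod g)\<^sup>2 / a\<close>, and the row bound says exactly that this is
    nonnegative.\<close>
  have nf: "nonneg_form D A'"
    unfolding nonneg_form_def
  proof
    fix x
    define g where "g = (\<Sum>j<D. A k j * x j)"
    define h where "h = (\<Sum>i<D. cnj (x i) * v i)"
    have "cnj g = (\<Sum>i<D. cnj (x i) * A i k)"
      unfolding g_def cnj_sum by (intro sum.cong refl) (simp add: herm[OF k(1)] mult.commute)
    then have h: "h = cnj g / complex_of_real (sqrt a)"
      by (simp add: h_def v_def sum_divide_distrib)
    have "qf D A' x = qf D A x - (\<Sum>i<D. \<Sum>j<D. (cnj (x i) * v i) * (x j * cnj (v j)))"
      unfolding sum_subtractf[symmetric] A'_def by (intro sum.cong refl) (simp add: algebra_simps)
    also have "(\<Sum>i<D. \<Sum>j<D. (cnj (x i) * v i) * (x j * cnj (v j))) = h * cnj h"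
      unfolding sum_product[symmetric] h_def by simp
    also have "h * cnj h = complex_of_real ((cmod g)\<^sup>2 / a)"
      unfolding complex_norm_square[symmetric] h norm_divide complex_mod_cnj using a by (simp add: power_divide)
    finally have q: "qf D A' x = qf D A x - complex_of_real ((cmod g)\<^sup>2 / a)" .
    have "(cmod g)\<^sup>2 / a \<le> Re (qf D A x)"
    proof (cases "a = 0")
      case True
      then show ?thesis using nonneg_formD(2)[OF Suc.prems(1)] by simp
    next
      case False
      then show ?thesis using row[of x] a by (simp add: g_def divide_le_eq mult.commute)
    qed
    moreover have "Im (qf D A x) = 0" by (rule nonneg_formD[OF Suc.prems(1)])
    ultimately show "Im (qf D A' x) = 0 \<and> 0 \<le> Re (qf D A' x)" unfolding q by simp
  qed
  have A'0: "A' i l = 0" if il: "i < D" "l < D" "i < D - j \<or> l < D - j" for i l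
  proof -
    consider "i = k" | "l = k" | "i < k" | "l < k" using il(3) k by linarith
    then show ?thesis
    proof cases
      case 2
      then show ?thesis using A'herm[OF k(1) il(1)] k0 il by simp
    next
      case 3
      then show ?thesis using z[OF il(1)] il(2) k(1) by (simp add: A'_def v_def)
    next
      case 4
      then show ?thesis using z[OF _ il(2)] z[OF il(2) k(1)] il(1) by (simp add: A'_def v_def)
    qed (use k0 il in simp)
  qed
  obtain \<phi> where \<phi>: "\<forall>i<D. \<forall>l<D. A' i l = (\<Sum>k<j. \<phi> k i * cnj (\<phi> k l))"
    using Suc.IH[OF nf Suc_leD[OF Suc.prems(2)] A'0] by blast
  have "A i l = (\<Sum>m<Suc j. (\<phi>(j := v)) m i * cnj ((\<phi>(j := v)) m l))" if "i < D" "l < D" for i l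
  proof -
    have "A i l = A' i l + v i * cnj (v l)" by (simp add: A'_def)
    then show ?thesis using \<phi> that by simp
  qed
  then show ?case by (intro exI[of _ "\<phi>(j := v)"] allI impI)
qed

lemma psd_decomposes:
  assumes "psd D M"
  obtains \<phi> where "decomposes D M {..<D} \<phi>"
proof -
  have "nonneg_form D (\<lambda>i j. M $$ (i, j))"
    unfolding nonneg_form_def
  proof
    fix x
    have q: "quad_form D M (vec D x) = qf D (\<lambda>i j. M $$ (i, j)) x"
      unfolding quad_form_def by (intro sum.cong refl) simp
    have "vec D x \<in> carrier_vec D" by simp
    then have "Im (quad_form D M (vec D x)) = 0 \<and> 0 \<le> Re (quad_form D M (vec D x))"
      using assms unfolding psd_def by blast
    then show "Im (qf D (\<lambda>i j. M $$ (i, j)) x) = 0 \<and> 0 \<le> Re (qf D (\<lambda>i j. M $$ (i, j)) x)"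
      unfolding q .
  qed
  \<comment> \<open>With \<open>j = D\<close> no row is eliminated yet and the vanishing condition
    is vacuous.\<close>
  from nonneg_form_outer_products[OF this order_refl] show ?thesis
    using that unfolding decomposes_def by auto
qed

section \<open>Polygamy of the negativity of assistance\<close>

text \<open>Completeness of the measurement: the outcomes together reproduce the partial
  trace.\<close>

lemma contract3_isometry:
  assumes "isometry r d U"
  shows "(\<Sum>m<r. contract3 d (U m) f i * cnj (contract3 d (U m) f j)) = (\<Sum>c<d. f (i * d + c) * cnj (f (j * d + c)))"
  using isometry_inner[OF assms, of "\<lambda>c. f (j * d + c)" "\<lambda>c. f (i * d + c)"]
  by (simp only: contract3_def mult.commute)

lemma contract2_isometry:
  assumes "isometry r 2 U"
  shows "(\<Sum>m<r. contract2 d (U m) f i * cnj (contract2 d (U m) f j))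
    = (\<Sum>b<2. f ((i div d) * (2 * d) + b * d + i mod d) * cnj (f ((j div d) * (2 * d) + b * d + j mod d)))"
  using isometry_inner[OF assms, of "\<lambda>b. f ((j div d) * (2 * d) + b * d + j mod d)" "\<lambda>b. f ((i div d) * (2 * d) + b * d + i mod d)"]
  by (simp only: contract2_def mult.commute)

text \<open>Each vector of the ensemble may be measured with its own isometry, because the partial
  trace does not depend on the measurement.\<close>

lemma reduced_12_decomposes:
  assumes \<phi>: "decomposes (2 * (2 * d)) \<rho> K \<phi>" and U: "\<And>k. isometry r d (U k)"
  shows "decomposes (2 * 2) (reduced_12 2 2 d \<rho>) (K \<times> {..<r}) (\<lambda>(k, m). contract3 d (U k m) (\<phi> k))"
  unfolding decomposes_def
proof (intro allI impI)
  fix i j :: nat assume ij: "i < 2 * 2" "j < 2 * 2"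
  have lt: "i * d + c < 2 * (2 * d)" if "i < 2 * 2" "c < d" for i c
  proof -
    have "i * d \<le> 3 * d" using that(1) by (intro mult_right_mono) auto
    then show ?thesis using that(2) by linarith
  qed
  have "reduced_12 2 2 d \<rho> $$ (i, j) = (\<Sum>c<d. \<rho> $$ (i * d + c, j * d + c))"
    using ij by (simp add: reduced_12_def ptrace_2_def)
  also have "\<dots> = (\<Sum>c<d. \<Sum>k\<in>K. \<phi> k (i * d + c) * cnj (\<phi> k (j * d + c)))"
    using \<phi> lt ij unfolding decomposes_def by (intro sum.cong refl) auto
  also have "\<dots> = (\<Sum>k\<in>K. \<Sum>m<r. contract3 d (U k m) (\<phi> k) i * cnj (contract3 d (U k m) (\<phi> k) j))"
    unfolding contract3_isometry[OF U] by (rule sum.swap)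
  also have "\<dots> = (\<Sum>x\<in>K \<times> {..<r}. (\<lambda>(k, m). contract3 d (U k m) (\<phi> k)) x i
      * cnj ((\<lambda>(k, m). contract3 d (U k m) (\<phi> k)) x j))"
    by (simp add: sum.cartesian_product case_prod_unfold)
  finally show "reduced_12 2 2 d \<rho> $$ (i, j) = (\<Sum>x\<in>K \<times> {..<r}. (\<lambda>(k, m). contract3 d (U k m) (\<phi> k)) x i
      * cnj ((\<lambda>(k, m). contract3 d (U k m) (\<phi> k)) x j))" .
qed

lemma reduced_13_decomposes:
  assumes \<phi>: "decomposes (2 * (2 * d)) \<rho> K \<phi>" and U: "\<And>k. isometry r 2 (U k)"
  shows "decomposes (2 * d) (reduced_13 2 2 d \<rho>) (K \<times> {..<r}) (\<lambda>(k, m). contract2 d (U k m) (\<phi> k))"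
  unfolding decomposes_def
proof (intro allI impI)
  fix i j :: nat assume ij: "i < 2 * d" "j < 2 * d"
  have lt: "(i div d) * (2 * d) + b * d + i mod d < 2 * (2 * d)" if "i < 2 * d" "b < 2" for i b
  proof -
    have d: "0 < d" using that(1) by simp
    have "i div d < 2" using that(1) d by (simp add: less_mult_imp_div_less)
    then have "(i div d) * (2 * d) \<le> 1 * (2 * d)" by (intro mult_right_mono) auto
    moreover have "b * d \<le> 1 * d" using that(2) by (intro mult_right_mono) auto
    moreover have "i mod d < d" using d by simp
    ultimately show ?thesis by linarith
  qed
  let ?n = "\<lambda>i b. (i div d) * (2 * d) + b * d + i mod d"
  have "reduced_13 2 2 d \<rho> $$ (i, j) = (\<Sum>b<2. \<rho> $$ (?n i b, ?n j b))"
    using ij by (simp add: reduced_13_def)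
  also have "\<dots> = (\<Sum>b<2. \<Sum>k\<in>K. \<phi> k (?n i b) * cnj (\<phi> k (?n j b)))"
    using \<phi> lt ij unfolding decomposes_def by (intro sum.cong refl) auto
  also have "\<dots> = (\<Sum>k\<in>K. \<Sum>m<r. contract2 d (U k m) (\<phi> k) i * cnj (contract2 d (U k m) (\<phi> k) j))"
    unfolding contract2_isometry[OF U] by (rule sum.swap)
  also have "\<dots> = (\<Sum>x\<in>K \<times> {..<r}. (\<lambda>(k, m). contract2 d (U k m) (\<phi> k)) x i
      * cnj ((\<lambda>(k, m). contract2 d (U k m) (\<phi> k)) x j))"
    by (simp add: sum.cartesian_product case_prod_unfold)
  finally show "reduced_13 2 2 d \<rho> $$ (i, j) = (\<Sum>x\<in>K \<times> {..<r}. (\<lambda>(k, m). contract2 d (U k m) (\<phi> k)) x i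
      * cnj ((\<lambda>(k, m). contract2 d (U k m) (\<phi> k)) x j))" .
qed

text \<open>Every vector of a decomposition of \<rho> is measured in the two bases from
  \<open>conc_tripartite_le\<close>. The collected outcomes decompose the two reduced states, so
  their concurrences sum to at most \<open>x\<close> and \<open>y\<close>.\<close>

lemma negativity_assist_polygamy:
  assumes "psd (2 * (2 * d)) \<rho>"
  defines "x \<equiv> negativity_assist 2 2 (reduced_12 2 2 d \<rho>)"
    and "y \<equiv> negativity_assist 2 d (reduced_13 2 2 d \<rho>)"
    and "z \<equiv> negativity_assist 2 (2 * d) \<rho>"
  shows "0 \<le> x" "0 \<le> y" "0 \<le> z" "z \<le> x + y"
proof -
  have c: "\<rho> \<in> carrier_mat (2 * (2 * d)) (2 * (2 * d))" using assms(1) by (simp add: psd_def)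
  have c12: "reduced_12 2 2 d \<rho> \<in> carrier_mat (2 * 2) (2 * 2)"
    by (simp add: reduced_12_def ptrace_2_def)
  have c13: "reduced_13 2 2 d \<rho> \<in> carrier_mat (2 * d) (2 * d)"
    by (simp add: reduced_13_def)
  have split: "\<exists>a b. 0 \<le> a \<and> 0 \<le> b \<and> a \<le> x \<and> b \<le> y \<and> (\<Sum>k<K. conc (2 * d) (\<phi> k)) \<le> a + b"
    if dec: "decomposes (2 * (2 * d)) \<rho> {..<K} \<phi>" for K :: nat and \<phi>
  proof -
    obtain U w where U: "\<And>k. isometry d d (U k)" and w: "\<And>k. isometry 2 2 (w k)"
      and le: "\<And>k. conc (2 * d) (\<phi> k) \<le> (\<Sum>m<d. conc 2 (contract3 d (U k m) (\<phi> k)))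
          + (\<Sum>m<2. conc d (contract2 d (w k m) (\<phi> k)))"
    proof -
      have "\<forall>k. \<exists>U w. isometry d d U \<and> isometry 2 2 w \<and> conc (2 * d) (\<phi> k)
          \<le> (\<Sum>m<d. conc 2 (contract3 d (U m) (\<phi> k))) + (\<Sum>m<2. conc d (contract2 d (w m) (\<phi> k)))"
        using conc_tripartite_le by blast
      then show ?thesis using that unfolding choice_iff by blast
    qed
    define a where "a = (\<Sum>k<K. \<Sum>m<d. conc 2 (contract3 d (U k m) (\<phi> k)))"
    define b where "b = (\<Sum>k<K. \<Sum>m<2. conc d (contract2 d (w k m) (\<phi> k)))"
    have "a = (\<Sum>p\<in>{..<K} \<times> {..<d}. conc 2 ((\<lambda>(k, m). contract3 d (U k m) (\<phi> k)) p))"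
      by (simp add: a_def sum.cartesian_product case_prod_unfold)
    also have "\<dots> \<le> x" unfolding x_def
      by (rule negativity_assist_ge[OF _ c12 reduced_12_decomposes[OF dec U]]) simp
    finally have ax: "a \<le> x" .
    have "b = (\<Sum>p\<in>{..<K} \<times> {..<2}. conc d ((\<lambda>(k, m). contract2 d (w k m) (\<phi> k)) p))"
      by (simp add: b_def sum.cartesian_product case_prod_unfold)
    also have "\<dots> \<le> y" unfolding y_def
      by (rule negativity_assist_ge[OF _ c13 reduced_13_decomposes[OF dec w]]) simp
    finally have "b \<le> y" .
    moreover have "(\<Sum>k<K. conc (2 * d) (\<phi> k)) \<le> a + b"
      unfolding a_def b_def sum.distrib[symmetric] by (intro sum_mono le)
    moreover have "0 \<le> a" "0 \<le> b" unfolding a_def b_def by (intro sum_nonneg conc_nonneg)+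
    ultimately show ?thesis using ax by blast
  qed
  obtain \<phi> where \<phi>: "decomposes (2 * (2 * d)) \<rho> {..<2 * (2 * d)} \<phi>"
    using psd_decomposes[OF assms(1)] .
  show "0 \<le> x" "0 \<le> y" using split[OF \<phi>] by linarith+
  have "0 \<le> (\<Sum>k<2 * (2 * d). conc (2 * d) (\<phi> k))" by (intro sum_nonneg conc_nonneg)
  also have "\<dots> \<le> z" unfolding z_def by (rule negativity_assist_ge[OF _ c \<phi>]) simp
  finally show "0 \<le> z" .
  show "z \<le> x + y" unfolding z_def
  proof (rule negativity_assist_le[OF _ c \<phi>])
    fix n :: nat and \<phi> assume "decomposes (2 * (2 * d)) \<rho> {..<n} \<phi>"
    from split[OF this] show "(\<Sum>k<n. conc (2 * d) (\<phi> k)) \<le> x + y" by linarith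
  qed simp
qed

theorem theorem4:
  fixes n :: nat and \<rho> :: "complex mat" and k q s \<beta> :: real
  assumes "n \<ge> 3"
    and "density (2 * 2 * 2 ^ (n - 2)) \<rho>"
    and "k \<ge> 1" and "0 < q" and "q \<le> 1" and "0 < s" and "s \<le> 1" and "\<beta> \<ge> s"
  shows
   "(negativity_assist 2 (2 ^ (n - 2)) (reduced_13 2 2 (2 ^ (n - 2)) \<rho>) powr s
       \<ge> k * negativity_assist 2 2 (reduced_12 2 2 (2 ^ (n - 2)) \<rho>) powr s \<longrightarrow>
     negativity_assist 2 (2 * 2 ^ (n - 2)) \<rho> powr \<beta>
       \<le> q powr (\<beta> / s) * negativity_assist 2 2 (reduced_12 2 2 (2 ^ (n - 2)) \<rho>) powr \<beta>
         + ((1 + k) powr (\<beta> / s) - q powr (\<beta> / s)) / k powr (\<beta> / s)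
           * negativity_assist 2 (2 ^ (n - 2)) (reduced_13 2 2 (2 ^ (n - 2)) \<rho>) powr \<beta>)
    \<and>
   (negativity_assist 2 2 (reduced_12 2 2 (2 ^ (n - 2)) \<rho>) powr s
       \<ge> k * negativity_assist 2 (2 ^ (n - 2)) (reduced_13 2 2 (2 ^ (n - 2)) \<rho>) powr s \<longrightarrow>
     negativity_assist 2 (2 * 2 ^ (n - 2)) \<rho> powr \<beta>
       \<le> q powr (\<beta> / s) * negativity_assist 2 (2 ^ (n - 2)) (reduced_13 2 2 (2 ^ (n - 2)) \<rho>) powr \<beta>
         + ((1 + k) powr (\<beta> / s) - q powr (\<beta> / s)) / k powr (\<beta> / s)
           * negativity_assist 2 2 (reduced_12 2 2 (2 ^ (n - 2)) \<rho>) powr \<beta>)"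
proof -
  have "psd (2 * (2 * 2 ^ (n - 2))) \<rho>" using assms(2) by (simp add: density_def)
  note polygamy = negativity_assist_polygamy[OF this]
  \<comment> \<open>The second part is the same real inequality with the two reduced states
    exchanged.\<close>
  show ?thesis
    using weighted_powr_bound[OF polygamy assms(3-8)]
      weighted_powr_bound[OF polygamy(2,1,3) _ assms(3-8)] polygamy(4)
    by (simp only: add.commute[of "negativity_assist 2 2 _"]) blast
qed

end
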